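(* Let $1<p<2$ and let $\{X_n, n\geqslant 1\}$ be a sequence of pairwise PQD random variables stochastically dominated by a random variable $X$ with $\mathbb{E}|X|^p<\infty$. Let $\{a_n\}$ be a sequence of real constants such that $\sup_{n\geqslant 1} n^{-1}\sum_{k=1}^n a_k^2<\infty$, and suppose that for some constant $C>0$ and some real sequence $(\lambda_j)$ with $\lambda_j = C\, j^{1/p}/\operatorname{Log}^{2/p} j + o\big(j^{1/p}/\operatorname{Log}^{2/p} j\big)$ as $j\to\infty$, \[ \sum_{1\leqslant k<j<\infty} |a_k a_j| \int_{\lambda_j}^{\infty} \left[\frac{1}{t^3\operatorname{Log}^2 t}+\frac{1}{(t\vee \mathrm{e})\,t^2\operatorname{Log}^3 t}\right] G_{X_k,X_j}(t)\,\mathrm{d}t<\infty . \] Then $\dfrac{1}{n^{1/p}\operatorname{Log} n}\sum_{k=1}^n a_k(X_k-\mathbb{E}X_k)\to 0$ almost surely.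
   Context: $\operatorname{Log} x := \log(|x|\vee \mathrm{e})$, and $\operatorname{Log}^a x$ means $(\operatorname{Log} x)^a$. A sequence $\{X_n\}$ is pairwise PQD if $\mathbb{P}\{X_k\leqslant x_k, X_j\leqslant x_j\}-\mathbb{P}\{X_k\leqslant x_k\}\mathbb{P}\{X_j\leqslant x_j\}\geqslant 0$ for all reals $x_k,x_j$ and all $k\neq j$. $\{X_n\}$ is stochastically dominated by $X$ if there is $C'>0$ with $\sup_{n}\mathbb{P}\{|X_n|>t\}\leqslant C'\,\mathbb{P}\{|X|>t\}$ for all $t>0$. For random variables $X,Y$ and $t>0$, $g_t(s)=\max(\min(s,t),-t)$, $\Delta_{X,Y}(x,y)=\mathbb{P}\{X\leqslant x,Y\leqslant y\}-\mathbb{P}\{X\leqslant x\}\mathbb{P}\{Y\leqslant y\}$, and $G_{X,Y}(t)=\mathrm{Cov}(g_t(X),g_t(Y))=\int_{-t}^t\int_{-t}^t\Delta_{X,Y}(x,y)\,\mathrm{d}x\,\mathrm{d}y$. *)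

theory Defs
  imports "HOL-Probability.Probability" "HOL-Library.Landau_Symbols"
begin

definition Log :: "real \<Rightarrow> real" where
  "Log x = ln (max \<bar>x\<bar> (exp 1))"

definition trunc_g :: "real \<Rightarrow> real \<Rightarrow> real" where
  "trunc_g t s = max (min s t) (- t)"

definition cov_trunc :: "'a measure \<Rightarrow> ('a \<Rightarrow> real) \<Rightarrow> ('a \<Rightarrow> real) \<Rightarrow> real \<Rightarrow> real" where
  "cov_trunc M X Y t =
     (\<integral>\<omega>. trunc_g t (X \<omega>) * trunc_g t (Y \<omega>) \<partial>M)
     - (\<integral>\<omega>. trunc_g t (X \<omega>) \<partial>M) * (\<integral>\<omega>. trunc_g t (Y \<omega>) \<partial>M)"

definition pairwise_PQD :: "'a measure \<Rightarrow> (nat \<Rightarrow> 'a \<Rightarrow> real) \<Rightarrow> bool" where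
  "pairwise_PQD M X \<longleftrightarrow>
     (\<forall>k j. 1 \<le> k \<longrightarrow> 1 \<le> j \<longrightarrow> k \<noteq> j \<longrightarrow> (\<forall>x y.
        measure M {\<omega> \<in> space M. X k \<omega> \<le> x \<and> X j \<omega> \<le> y}
        - measure M {\<omega> \<in> space M. X k \<omega> \<le> x} * measure M {\<omega> \<in> space M. X j \<omega> \<le> y} \<ge> 0))"

definition stoch_dominated :: "'a measure \<Rightarrow> (nat \<Rightarrow> 'a \<Rightarrow> real) \<Rightarrow> ('a \<Rightarrow> real) \<Rightarrow> bool" where
  "stoch_dominated M X Y \<longleftrightarrow>
     (\<exists>C'>0. \<forall>n\<ge>1. \<forall>t>0.
        measure M {\<omega> \<in> space M. \<bar>X n \<omega>\<bar> > t} \<le> C' * measure M {\<omega> \<in> space M. \<bar>Y \<omega>\<bar> > t})"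

end

theory Submission
  imports Defs "HOL-Real_Asymp.Real_Asymp"
begin

text \<open>For the indices up to \<open>2 ^ m\<close> truncate at \<open>c m = 2 powr (m / p) / m\<close>.
  The truncated, centred sums are controlled in mean square by the dyadic Rademacher--Menshov
  inequality, which costs a factor \<open>m\<^sup>2\<close> that is exactly absorbed by the square of the logarithm in the
  norming sequence. What remains are sums of covariances: the diagonal ones are handled by
  stochastic domination, and for the off-diagonal ones Hoeffding's formula shows that the truncated
  covariance is nonnegative and increasing in the truncation level, so that the sum over the levels
  is bounded by the integral in the hypothesis.
  The parts beyond the truncation level are small already in mean: their absolute moments,
  divided by \<open>2 powr (m / p) * m\<close>, are summable over m because the levels grow geometrically and p is less than 2.\<close>

section \<open>Geometrically growing levels\<close>

text \<open>Pairwise dependence offers no maximal inequality of independent type, and the summands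
  have no fixed sign, so partial sums cannot be interpolated monotonically between powers of two.
  Rademacher--Menshov sees only covariances, and it needs no orthogonality once these enter through
  their absolute values. Clipping with \<open>trunc_g\<close>, instead of cutting with an indicator,
  serves twice. The covariance of clipped variables is the integral of the PQD difference over a box
  that grows with the level. And the superlevel sets of the clipped square and of the excess are
  tail events of the variable, which is what stochastic domination is able to compare. The level
  depends on the block and not on the index, so a pair k < j is met at every level m with j < 2 ^ m
  (indices counted from 0). Interchanging the sum over m with the sum over pairs is what produces a
  single integral per pair.\<close>

lemma geometric_sum_below_one:
  fixes d :: "nat \<Rightarrow> real"
  assumes pos: "\<And>m. d m > 0" and grow: "\<And>m. \<rho> * d m \<le> d (Suc m)" and "\<rho> > 1" "s > 0"
  shows "(\<Sum>m<N. if d m \<le> 1 then d m powr s else 0) \<le> \<rho> powr s / (\<rho> powr s - 1)"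
proof -
  define K where "K = 1 / (\<rho> powr s - 1)"
  have r: "\<rho> powr s > 1" using assms by simp
  hence K: "K > 0" and KK: "K + 1 = \<rho> powr s * K" "K + 1 = \<rho> powr s / (\<rho> powr s - 1)"
    by (auto simp: K_def field_simps)
  have step: "\<rho> powr s * d m powr s \<le> d (Suc m) powr s" for m
    using grow[of m] less_imp_le[OF pos[of m]] assms(3,4) powr_mono2[of s "\<rho> * d m" "d (Suc m)"]
    by (simp add: powr_mult)
  \<comment> \<open>The bound \<open>K + 1\<close> alone is not inductive, since each step may add a
    term of size up to 1. Its companion \<open>K * d N powr s\<close> is the geometric series read
    backwards from N; adding \<open>d N powr s\<close> to it gives \<open>K + 1\<close> at most, as
    long as \<open>d N \<le> 1\<close>.\<close>
  have "(\<Sum>m<N. if d m \<le> 1 then d m powr s else 0) \<le> K * d N powr s \<and>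
        (\<Sum>m<N. if d m \<le> 1 then d m powr s else 0) \<le> K + 1"
  proof (induction N)
    case 0 then show ?case using K by simp
  next
    case (Suc N)
    have s1: "K * (\<rho> powr s * d N powr s) \<le> K * d (Suc N) powr s"
      using step K by (intro mult_left_mono) auto
    show ?case
    proof (cases "d N \<le> 1")
      case True
      have "d N powr s \<le> 1" using True pos[of N] assms by (simp add: powr_le1 less_imp_le)
      hence "(K + 1) * d N powr s \<le> (K + 1) * 1" using K by (intro mult_left_mono) auto
      moreover have "(K + 1) * d N powr s \<le> K * d (Suc N) powr s"
        using s1 KK(1) by (simp add: mult_ac)
      ultimately show ?thesis using Suc True by (auto simp: algebra_simps)
    next
      case False
      have "1 * (K * d N powr s) \<le> \<rho> powr s * (K * d N powr s)"
        using r K by (intro mult_right_mono) auto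
      thus ?thesis using Suc False s1 by (auto simp: mult_ac)
    qed
  qed
  thus ?thesis using KK by simp
qed

lemma geometric_sum_above_one:
  fixes d :: "nat \<Rightarrow> real"
  assumes pos: "\<And>m. d m > 0" and grow: "\<And>m. \<rho> * d m \<le> d (Suc m)" and "\<rho> > 1" "s > 0"
  shows "(\<Sum>m<N. if d m \<ge> 1 then d m powr (-s) else 0) \<le> \<rho> powr s / (\<rho> powr s - 1)"
proof -
  define L where "L = \<rho> powr s / (\<rho> powr s - 1)"
  have r: "\<rho> powr s > 1" using assms by simp
  hence L: "L > 0" and LL: "L - 1 = \<rho> powr (-s) * L"
    by (auto simp: L_def field_simps powr_minus)
  have step: "d (Suc m) powr (-s) \<le> \<rho> powr (-s) * d m powr (-s)" for m
    using grow[of m] pos[of m] assms by (subst powr_mult[symmetric]) (auto intro!: powr_mono2')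
  \<comment> \<open>The subtracted term is a reserve for the summands from N on: a geometric series
    starting at \<open>d N powr (-s)\<close> costs at most L times its first term. The minimum with
    1 covers the N at which the series has not yet begun.\<close>
  have "(\<Sum>m<N. if d m \<ge> 1 then d m powr (-s) else 0) \<le> L - L * min 1 (d N powr (-s))"
  proof (induction N)
    case 0 then show ?case using L by simp
  next
    case (Suc N)
    show ?case
    proof (cases "d N \<ge> 1")
      case True
      have "d N powr (-s) \<le> 1" using True assms powr_mono2'[of "-s" 1 "d N"] by simp
      moreover have "L * min 1 (d (Suc N) powr (-s)) \<le> L * (\<rho> powr (-s) * d N powr (-s))"
        using L step[of N] by (intro mult_left_mono) auto
      hence "L * min 1 (d (Suc N) powr (-s)) \<le> (L - 1) * d N powr (-s)"
        by (simp add: LL mult_ac)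
      ultimately show ?thesis using Suc True by (simp add: algebra_simps)
    next
      case False
      have "d N powr (-s) \<ge> 1" using False assms pos[of N] powr_mono2'[of "-s" "d N" 1] by simp
      moreover have "L * min 1 (d (Suc N) powr (-s)) \<le> L * 1"
        using L by (intro mult_left_mono) auto
      ultimately show ?thesis using Suc False by simp
    qed
  qed
  also have "\<dots> \<le> L" using L by simp
  finally show ?thesis by (simp add: L_def)
qed

section \<open>The Rademacher--Menshov inequality\<close>

lemma partial_sum_le_dyadic_squares:
  fixes z :: "nat \<Rightarrow> real"
  assumes "n < 2 ^ m"
  shows "(\<Sum>k<n. z k)\<^sup>2 \<le> real m * (\<Sum>l<m. \<Sum>b<2 ^ (m - l). (\<Sum>k=b * 2 ^ l..<b * 2 ^ l + 2 ^ l. z k)\<^sup>2)"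
proof -
  define Q where "Q l = (\<Sum>b<2 ^ (m - l). (\<Sum>k=b * 2 ^ l..<b * 2 ^ l + 2 ^ l. z k)\<^sup>2)" for l :: nat
  define S where "S i = (\<Sum>k<i. z k)" for i :: nat
  have Q0: "Q l \<ge> 0" for l unfolding Q_def by (intro sum_nonneg) auto
  \<comment> \<open>Clearing the binary digits of n one at a time, each change of the partial sum is empty or one dyadic block.\<close>
  have one: "\<bar>S (2 ^ l * (n div 2 ^ l)) - S (2 ^ Suc l * (n div 2 ^ Suc l))\<bar> \<le> sqrt (Q l)"
    if "l < m" for l
  proof -
    define q where "q = n div 2 ^ l"
    have "n div 2 ^ Suc l = q div 2" unfolding q_def
      by (metis div_mult2_eq mult.commute power_Suc)
    show ?thesis
    proof (cases "even q")
      case True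
      then have "2 ^ Suc l * (q div 2) = 2 ^ l * q" by auto
      hence "2 ^ Suc l * (n div 2 ^ Suc l) = 2 ^ l * (n div 2 ^ l)"
        using \<open>n div 2 ^ Suc l = q div 2\<close> by (simp only: q_def)
      thus ?thesis using Q0[of l] by (simp only:) simp
    next
      case False
      then obtain b where b: "q = Suc (2 * b)" by (metis oddE Suc_eq_plus1)
      have "n < 2 ^ (m - l) * 2 ^ l" using assms that by (simp flip: power_add)
      hence "q < 2 ^ (m - l)" unfolding q_def by (simp add: less_mult_imp_div_less)
      hence bl: "2 * b < 2 ^ (m - l)" using b by simp
      have e1: "2 ^ l * q = 2 * b * 2 ^ l + 2 ^ l" by (simp add: b algebra_simps)
      have e2: "2 ^ Suc l * (q div 2) = 2 * b * 2 ^ l" by (simp add: b algebra_simps)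
      have "S (2 * b * 2 ^ l + 2 ^ l) - S (2 * b * 2 ^ l) = (\<Sum>k=2 * b * 2 ^ l..<2 * b * 2 ^ l + 2 ^ l. z k)"
        unfolding S_def lessThan_atLeast0 by (subst sum_diff_nat_ivl) auto
      moreover have "(\<Sum>k=2 * b * 2 ^ l..<2 * b * 2 ^ l + 2 ^ l. z k)\<^sup>2 \<le> Q l"
        unfolding Q_def using bl
        by (intro member_le_sum[where f="\<lambda>b. (\<Sum>k=b * 2 ^ l..<b * 2 ^ l + 2 ^ l. z k)\<^sup>2"]) auto
      ultimately show ?thesis
        using e1 e2 \<open>n div 2 ^ Suc l = q div 2\<close> by (metis q_def real_le_rsqrt power2_abs)
    qed
  qed
  have "\<bar>S n - S (2 ^ L * (n div 2 ^ L))\<bar> \<le> (\<Sum>l<L. sqrt (Q l))" if "L \<le> m" for L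
    using that
  proof (induction L)
    case 0 then show ?case by simp
  next
    case (Suc L)
    then show ?case using one[of L] by simp
  qed
  from this[of m] have "\<bar>S n\<bar> \<le> (\<Sum>l<m. sqrt (Q l))" using assms by (simp add: S_def)
  hence "(S n)\<^sup>2 \<le> (\<Sum>l<m. sqrt (Q l))\<^sup>2" by (metis abs_ge_zero power2_abs power_mono)
  \<comment> \<open>Cauchy--Schwarz over the m binary digits costs the first factor m. As
    \<open>Q l\<close> collects all blocks of its level, the bound no longer depends on n.\<close>
  also have "\<dots> \<le> (\<Sum>l<m. (sqrt (Q l))\<^sup>2) * (\<Sum>l<m. 1\<^sup>2)"
    using Cauchy_Schwarz_ineq_sum[of "\<lambda>l. sqrt (Q l)" "\<lambda>_. 1" "{..<m}"] by simp
  also have "\<dots> = real m * (\<Sum>l<m. Q l)" using Q0 by (simp add: mult_ac)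
  finally show ?thesis by (simp add: Q_def S_def)
qed

text \<open>One majorant W serves all partial sums at once. The second factor m counts the levels:
  the blocks of one level are disjoint squares on the diagonal of the index square, so each level
  costs at most the full double sum of absolute covariances.\<close>

lemma rademacher_menshov:
  fixes z :: "nat \<Rightarrow> 'a \<Rightarrow> real"
  assumes int: "\<And>k j. integrable M (\<lambda>\<omega>. z k \<omega> * z j \<omega>)"
  obtains W where "integrable M W" "\<And>\<omega>. W \<omega> \<ge> 0"
    "\<And>n \<omega>. n < 2 ^ m \<Longrightarrow> (\<Sum>k<n. z k \<omega>)\<^sup>2 \<le> W \<omega>"
    "(\<integral>\<omega>. W \<omega> \<partial>M) \<le> (real m)\<^sup>2 * (\<Sum>k<2^m. \<Sum>j<2^m. \<bar>\<integral>\<omega>. z k \<omega> * z j \<omega> \<partial>M\<bar>)"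
proof
  let ?B = "\<lambda>l b. {b * 2 ^ l..<b * 2 ^ l + 2 ^ l :: nat}"
  define W where "W \<omega> = real m * (\<Sum>l<m. \<Sum>b<2 ^ (m - l). \<Sum>k\<in>?B l b. \<Sum>j\<in>?B l b. z k \<omega> * z j \<omega>)" for \<omega>
  let ?c = "\<lambda>k j. \<bar>\<integral>\<omega>. z k \<omega> * z j \<omega> \<partial>M\<bar>"
  have W: "W \<omega> = real m * (\<Sum>l<m. \<Sum>b<2 ^ (m - l). (\<Sum>k\<in>?B l b. z k \<omega>)\<^sup>2)" for \<omega>
    by (simp add: W_def power2_eq_square sum_product)
  show "integrable M W" unfolding W_def by (intro integrable_mult_right Bochner_Integration.integrable_sum int)
  show "W \<omega> \<ge> 0" for \<omega> unfolding W by (intro mult_nonneg_nonneg sum_nonneg) auto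
  show "(\<Sum>k<n. z k \<omega>)\<^sup>2 \<le> W \<omega>" if "n < 2 ^ m" for n \<omega>
    unfolding W by (rule partial_sum_le_dyadic_squares[OF that])
  have level: "(\<Sum>b<2 ^ (m - l). \<Sum>k\<in>?B l b. \<Sum>j\<in>?B l b. \<integral>\<omega>. z k \<omega> * z j \<omega> \<partial>M)
      \<le> (\<Sum>k<2^m. \<Sum>j<2^m. ?c k j)" if "l < m" for l
  proof -
    have sub: "?B l b \<subseteq> {..<2 ^ m}" if "b < 2 ^ (m - l)" for b
    proof -
      have "(b + 1) * 2 ^ l \<le> 2 ^ (m - l) * 2 ^ l" using that by (intro mult_right_mono) auto
      thus ?thesis using \<open>l < m\<close> by (auto simp flip: power_add simp: algebra_simps)
    qed
    have "(\<Sum>b<2 ^ (m - l). \<Sum>k\<in>?B l b. \<Sum>j\<in>?B l b. \<integral>\<omega>. z k \<omega> * z j \<omega> \<partial>M)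
      \<le> (\<Sum>b<2 ^ (m - l). \<Sum>k\<in>?B l b. \<Sum>j\<in>?B l b. ?c k j)"
      by (intro sum_mono) auto
    also have "\<dots> \<le> (\<Sum>b<2 ^ (m - l). \<Sum>k\<in>?B l b. \<Sum>j<2^m. ?c k j)"
      using sub by (intro sum_mono sum_mono2) auto
    also have "\<dots> = (\<Sum>k<2 ^ (m - l) * 2 ^ l. \<Sum>j<2^m. ?c k j)" by (rule sum.nat_group)
    finally show ?thesis using that by (simp flip: power_add)
  qed
  have "(\<integral>\<omega>. W \<omega> \<partial>M) = real m * (\<Sum>l<m. \<Sum>b<2 ^ (m - l). \<Sum>k\<in>?B l b. \<Sum>j\<in>?B l b. \<integral>\<omega>. z k \<omega> * z j \<omega> \<partial>M)"
    unfolding W_def using int by (simp add: Bochner_Integration.integral_sum)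
  also have "\<dots> \<le> real m * (\<Sum>l<m. (\<Sum>k<2^m. \<Sum>j<2^m. ?c k j))"
    using level by (intro mult_left_mono sum_mono) auto
  finally show "(\<integral>\<omega>. W \<omega> \<partial>M) \<le> (real m)\<^sup>2 * (\<Sum>k<2^m. \<Sum>j<2^m. ?c k j)"
    by (simp add: power2_eq_square)
qed

section \<open>Tail domination\<close>

lemma nn_integral_layer_cake:
  assumes [measurable]: "f \<in> borel_measurable M" and "sigma_finite_measure M"
    and nonneg: "\<And>\<omega>. f \<omega> \<ge> 0"
  shows "(\<integral>\<^sup>+\<omega>. ennreal (f \<omega>) \<partial>M)
    = (\<integral>\<^sup>+t. indicator {0<..} t * emeasure M {\<omega> \<in> space M. t < f \<omega>} \<partial>lborel)"
proof -
  interpret sigma_finite_measure M by fact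
  interpret pair_sigma_finite lborel M ..
  have "(\<integral>\<^sup>+\<omega>. ennreal (f \<omega>) \<partial>M) = (\<integral>\<^sup>+\<omega>. \<integral>\<^sup>+t. indicator {t. 0 < t \<and> t < f \<omega>} t \<partial>lborel \<partial>M)"
  proof (intro nn_integral_cong)
    fix \<omega>
    have "{t. 0 < t \<and> t < f \<omega>} = {0<..<f \<omega>}" by auto
    then show "ennreal (f \<omega>) = (\<integral>\<^sup>+t. indicator {t. 0 < t \<and> t < f \<omega>} t \<partial>lborel)"
      using nonneg[of \<omega>] by simp
  qed
  also have "\<dots> = (\<integral>\<^sup>+\<omega>. \<integral>\<^sup>+t. indicator {x. 0 < fst x \<and> fst x < f (snd x)} (t, \<omega>) \<partial>lborel \<partial>M)"
    by (intro nn_integral_cong) (auto split: split_indicator)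
  also have "\<dots> = (\<integral>\<^sup>+t. \<integral>\<^sup>+\<omega>. indicator {x. 0 < fst x \<and> fst x < f (snd x)} (t, \<omega>) \<partial>M \<partial>lborel)"
    by (rule Fubini') measurable
  also have "\<dots> = (\<integral>\<^sup>+t. indicator {0<..} t * emeasure M {\<omega> \<in> space M. t < f \<omega>} \<partial>lborel)"
  proof (intro nn_integral_cong)
    fix t :: real
    have "(\<integral>\<^sup>+\<omega>. indicator {x. 0 < fst x \<and> fst x < f (snd x)} (t, \<omega>) \<partial>M)
      = (\<integral>\<^sup>+\<omega>. indicator {0<..} t * indicator {\<omega> \<in> space M. t < f \<omega>} \<omega> \<partial>M)"
      by (intro nn_integral_cong) (auto split: split_indicator)
    also have "\<dots> = indicator {0<..} t * emeasure M {\<omega> \<in> space M. t < f \<omega>}"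
      by (subst nn_integral_cmult) auto
    finally show "(\<integral>\<^sup>+\<omega>. indicator {x. 0 < fst x \<and> fst x < f (snd x)} (t, \<omega>) \<partial>M) = \<dots>" .
  qed
  finally show ?thesis .
qed

lemma nn_integral_le_of_tail_le:
  assumes [measurable]: "f \<in> borel_measurable M" "g \<in> borel_measurable M" and "finite_measure M"
    and "\<And>\<omega>. f \<omega> \<ge> 0" "\<And>\<omega>. g \<omega> \<ge> 0" "C \<ge> 0"
    and tail: "\<And>t. t > 0 \<Longrightarrow> measure M {\<omega> \<in> space M. t < f \<omega>} \<le> C * measure M {\<omega> \<in> space M. t < g \<omega>}"
  shows "(\<integral>\<^sup>+\<omega>. ennreal (f \<omega>) \<partial>M) \<le> ennreal C * (\<integral>\<^sup>+\<omega>. ennreal (g \<omega>) \<partial>M)"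
proof -
  interpret finite_measure M by fact
  have sf: "sigma_finite_measure M" ..
  interpret pair_sigma_finite lborel M ..
  have [measurable]: "(\<lambda>t. emeasure M {\<omega> \<in> space M. t < g \<omega>}) \<in> borel_measurable lborel"
    by measurable
  have "(\<integral>\<^sup>+\<omega>. ennreal (f \<omega>) \<partial>M) = (\<integral>\<^sup>+t. indicator {0<..} t * emeasure M {\<omega> \<in> space M. t < f \<omega>} \<partial>lborel)"
    using sf assms by (intro nn_integral_layer_cake)
  also have "\<dots> \<le> (\<integral>\<^sup>+t. ennreal C * (indicator {0<..} t * emeasure M {\<omega> \<in> space M. t < g \<omega>}) \<partial>lborel)"
    using tail \<open>C \<ge> 0\<close>
    by (intro nn_integral_mono)
       (auto split: split_indicator simp: emeasure_eq_measure ennreal_mult'[symmetric])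
  also have "\<dots> = ennreal C * (\<integral>\<^sup>+t. indicator {0<..} t * emeasure M {\<omega> \<in> space M. t < g \<omega>} \<partial>lborel)"
    by (intro nn_integral_cmult) measurable
  also have "(\<integral>\<^sup>+t. indicator {0<..} t * emeasure M {\<omega> \<in> space M. t < g \<omega>} \<partial>lborel) = (\<integral>\<^sup>+\<omega>. ennreal (g \<omega>) \<partial>M)"
    using sf assms by (intro nn_integral_layer_cake[symmetric])
  finally show ?thesis .
qed

text \<open>The form in which stochastic domination is applied: to f and g built in the same way
  from \<open>X n\<close> and from Y, such that their superlevel sets are tail events. Integrability
  of f is part of the gain, since only moments of Y are given.\<close>

lemma integral_le_of_tail_le:
  assumes [measurable]: "f \<in> borel_measurable M" and g: "integrable M g" and "finite_measure M"
    and f0: "\<And>\<omega>. f \<omega> \<ge> 0" and g0: "\<And>\<omega>. g \<omega> \<ge> 0" and C: "C \<ge> 0"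
    and tail: "\<And>t. t > 0 \<Longrightarrow> measure M {\<omega> \<in> space M. t < f \<omega>} \<le> C * measure M {\<omega> \<in> space M. t < g \<omega>}"
  shows "integrable M f" "(\<integral>\<omega>. f \<omega> \<partial>M) \<le> C * (\<integral>\<omega>. g \<omega> \<partial>M)"
proof -
  have "(\<integral>\<^sup>+\<omega>. ennreal (f \<omega>) \<partial>M) \<le> ennreal C * (\<integral>\<^sup>+\<omega>. ennreal (g \<omega>) \<partial>M)"
    using assms by (intro nn_integral_le_of_tail_le) auto
  also have "\<dots> = ennreal (C * (\<integral>\<omega>. g \<omega> \<partial>M))"
    using g g0 C by (subst nn_integral_eq_integral) (auto simp: ennreal_mult')
  finally have le: "(\<integral>\<^sup>+\<omega>. ennreal (f \<omega>) \<partial>M) \<le> ennreal (C * (\<integral>\<omega>. g \<omega> \<partial>M))" .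
  show int: "integrable M f"
    using le f0 by (intro integrableI_nonneg) (auto intro: le_less_trans)
  have "0 \<le> C * (\<integral>\<omega>. g \<omega> \<partial>M)" using g0 C by simp
  with le show "(\<integral>\<omega>. f \<omega> \<partial>M) \<le> C * (\<integral>\<omega>. g \<omega> \<partial>M)"
    using int f0 by (subst (asm) nn_integral_eq_integral) auto
qed

text \<open>Stands in for Markov plus Borel--Cantelli: the sum of the \<open>W n\<close> has finite
  integral, hence is finite almost everywhere, and its terms tend to 0.\<close>

lemma AE_tendsto_zero_of_summable_integral:
  fixes W :: "nat \<Rightarrow> 'a \<Rightarrow> real"
  assumes int: "\<And>n. integrable M (W n)" and nonneg: "\<And>n \<omega>. W n \<omega> \<ge> 0"
    and "summable (\<lambda>n. \<integral>\<omega>. W n \<omega> \<partial>M)"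
  shows "AE \<omega> in M. (\<lambda>n. W n \<omega>) \<longlonglongrightarrow> 0"
proof -
  have [measurable]: "W n \<in> borel_measurable M" for n using int by auto
  have "(\<integral>\<^sup>+\<omega>. (\<Sum>n. ennreal (W n \<omega>)) \<partial>M) = (\<Sum>n. \<integral>\<^sup>+\<omega>. ennreal (W n \<omega>) \<partial>M)"
    by (intro nn_integral_suminf) measurable
  also have "\<dots> = (\<Sum>n. ennreal (\<integral>\<omega>. W n \<omega> \<partial>M))"
    using int nonneg by (simp add: nn_integral_eq_integral)
  also have "\<dots> \<noteq> \<infinity>"
    using assms by (subst suminf_ennreal2) auto
  finally have "AE \<omega> in M. (\<Sum>n. ennreal (W n \<omega>)) \<noteq> \<infinity>"
    by (intro nn_integral_PInf_AE) auto
  then show ?thesis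
  proof eventually_elim
    case (elim \<omega>)
    then have "summable (\<lambda>n. W n \<omega>)" using nonneg by (intro summable_suminf_not_top) auto
    then show ?case by (rule summable_LIMSEQ_zero)
  qed
qed

section \<open>Hoeffding's covariance formula\<close>

lemma trunc_g_measurable [measurable]: "trunc_g t \<in> borel_measurable borel"
  unfolding trunc_g_def[abs_def] by measurable

lemma abs_trunc_g_le: "t \<ge> 0 \<Longrightarrow> \<bar>trunc_g t s\<bar> \<le> t"
  by (auto simp: trunc_g_def)

text \<open>Reflecting to \<open>t - trunc_g t s\<close> makes the clipped value the length of one
  interval, of endpoints \<open>max s (-t)\<close> and t (empty if s > t). Covariances do not change
  when both factors are reflected.\<close>

lemma trunc_g_eq_integral:
  assumes "t \<ge> 0"
  shows "t - trunc_g t s = (\<integral>u. indicator {-t..t} u * indicator {s..} u \<partial>lborel)"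
proof -
  have "(\<lambda>u::real. indicator {-t..t} u * indicator {s..} u :: real) = indicator {max s (-t)..t}"
    by (auto simp: fun_eq_iff split: split_indicator)
  then show ?thesis using assms by (simp add: trunc_g_def max_def min_def)
qed

text \<open>The difference \<Delta> of the definition of PQD; pairwise PQD is its nonnegativity at
  every point.\<close>

definition joint_excess :: "'a measure \<Rightarrow> ('a \<Rightarrow> real) \<Rightarrow> ('a \<Rightarrow> real) \<Rightarrow> real \<Rightarrow> real \<Rightarrow> real" where
  "joint_excess M X Y x y = measure M {\<omega> \<in> space M. X \<omega> \<le> x \<and> Y \<omega> \<le> y}
     - measure M {\<omega> \<in> space M. X \<omega> \<le> x} * measure M {\<omega> \<in> space M. Y \<omega> \<le> y}"

text \<open>After reflection both factors are integrals over u of the indicator of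
  \<open>X \<omega> \<le> u\<close>, and Fubini moves the expectation inside: \<open>joint\<close>
  gives the joint distribution function, \<open>prod\<close> the product of the marginals.
  Integrability is stated as well because comparing two levels requires it.\<close>

lemma hoeffding_cov_trunc:
  assumes "prob_space M" and [measurable]: "X \<in> borel_measurable M" "Y \<in> borel_measurable M"
    and t: "t \<ge> 0"
  shows "integrable (lborel \<Otimes>\<^sub>M lborel)
      (\<lambda>(u, v). indicator {-t..t} u * indicator {-t..t} v * joint_excess M X Y u v)" (is ?I)
    and "cov_trunc M X Y t = (\<integral>(u, v). indicator {-t..t} u * indicator {-t..t} v
           * joint_excess M X Y u v \<partial>(lborel \<Otimes>\<^sub>M lborel))" (is ?E)
proof -
  interpret prob_space M by fact
  interpret LM: pair_sigma_finite M "lborel :: real measure" ..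
  interpret LLM: pair_sigma_finite M "(lborel :: real measure) \<Otimes>\<^sub>M (lborel :: real measure)" ..
  define F where "F x = measure M {\<omega> \<in> space M. X \<omega> \<le> x}" for x
  define G where "G x = measure M {\<omega> \<in> space M. Y \<omega> \<le> x}" for x
  define H where "H x y = measure M {\<omega> \<in> space M. X \<omega> \<le> x \<and> Y \<omega> \<le> y}" for x y
  let ?b = "\<lambda>u. indicator {-t..t} u :: real"
  have [measurable]: "F \<in> borel_measurable borel" "G \<in> borel_measurable borel"
      "(\<lambda>p. H (fst p) (snd p)) \<in> borel_measurable (lborel \<Otimes>\<^sub>M lborel)"
    unfolding F_def[abs_def] G_def[abs_def] H_def by measurable
  have box: "emeasure (lborel \<Otimes>\<^sub>M lborel) ({-t..t} \<times> {-t..t}) < \<infinity>"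
    using t by (subst lborel.emeasure_pair_measure_Times) (auto simp: ennreal_mult_less_top)
  have bound: "integrable (lborel \<Otimes>\<^sub>M lborel) (\<lambda>p. ?b (fst p) * ?b (snd p) * h p)"
    if [measurable]: "h \<in> borel_measurable (lborel \<Otimes>\<^sub>M lborel)" and "\<And>p. \<bar>h p\<bar> \<le> 1" for h
  proof (rule Bochner_Integration.integrable_bound)
    show "integrable (lborel \<Otimes>\<^sub>M lborel) (indicator ({-t..t} \<times> {-t..t}) :: real \<times> real \<Rightarrow> real)"
      using box by (intro integrable_real_indicator) auto
  qed (use that in \<open>auto split: split_indicator simp: indicator_def\<close>)
  have iH: "integrable (lborel \<Otimes>\<^sub>M lborel) (\<lambda>p. ?b (fst p) * ?b (snd p) * H (fst p) (snd p))"
    by (intro bound) (auto simp: H_def)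
  have iFG: "integrable (lborel \<Otimes>\<^sub>M lborel) (\<lambda>p. ?b (fst p) * ?b (snd p) * (F (fst p) * G (snd p)))"
    by (intro bound) (auto simp: F_def G_def abs_mult intro!: mult_le_one)
  have eq: "(\<lambda>(u, v). ?b u * ?b v * joint_excess M X Y u v)
     = (\<lambda>p. ?b (fst p) * ?b (snd p) * H (fst p) (snd p) - ?b (fst p) * ?b (snd p) * (F (fst p) * G (snd p)))"
    by (auto simp: joint_excess_def F_def G_def H_def algebra_simps)
  show ?I unfolding eq using iH iFG by (rule Bochner_Integration.integrable_diff)

  have marg: "t - (\<integral>\<omega>. trunc_g t (Z \<omega>) \<partial>M) = (\<integral>u. ?b u * measure M {\<omega> \<in> space M. Z \<omega> \<le> u} \<partial>lborel)"
    if [measurable]: "Z \<in> borel_measurable M" for Z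
  proof -
    have int: "integrable M (\<lambda>\<omega>. trunc_g t (Z \<omega>))"
      using t by (intro integrable_const_bound[where B=t]) (auto intro!: abs_trunc_g_le)
    have "t - (\<integral>\<omega>. trunc_g t (Z \<omega>) \<partial>M) = (\<integral>\<omega>. t - trunc_g t (Z \<omega>) \<partial>M)"
      using int by (simp add: prob_space)
    also have "\<dots> = (\<integral>\<omega>. \<integral>u. ?b u * indicator {Z \<omega>..} u \<partial>lborel \<partial>M)"
      using t by (simp add: trunc_g_eq_integral)
    also have "\<dots> = (\<integral>u. \<integral>\<omega>. ?b u * indicator {Z \<omega>..} u \<partial>M \<partial>lborel)"
    proof (rule LM.Fubini_integral[symmetric], unfold split_beta')
      show "integrable (M \<Otimes>\<^sub>M lborel) (\<lambda>x. ?b (snd x) * indicator {Z (fst x)..} (snd x))"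
      proof (rule Bochner_Integration.integrable_bound)
        show "integrable (M \<Otimes>\<^sub>M lborel) (indicator (space M \<times> {-t..t}) :: 'a \<times> real \<Rightarrow> real)"
          using t by (intro integrable_real_indicator)
             (auto simp: lborel.emeasure_pair_measure_Times emeasure_space_1)
        show "AE x in M \<Otimes>\<^sub>M lborel. norm (?b (snd x) * indicator {Z (fst x)..} (snd x))
          \<le> norm (indicator (space M \<times> {-t..t}) x :: real)"
          by (auto split: split_indicator simp: indicator_def space_pair_measure)
      \<comment> \<open>The half-line moves with the sample point; unfolded, its indicator is a
        comparison between two measurable functions.\<close>
      qed (unfold indicator_def atLeast_iff, measurable)
    qed
    also have "\<dots> = (\<integral>u. ?b u * measure M {\<omega> \<in> space M. Z \<omega> \<le> u} \<partial>lborel)"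
    proof (intro Bochner_Integration.integral_cong refl)
      fix u :: real
      have "(\<integral>\<omega>. ?b u * indicator {Z \<omega>..} u \<partial>M) = (\<integral>\<omega>. ?b u * indicator {\<omega> \<in> space M. Z \<omega> \<le> u} \<omega> \<partial>M)"
        by (intro Bochner_Integration.integral_cong) (auto split: split_indicator)
      then show "(\<integral>\<omega>. ?b u * indicator {Z \<omega>..} u \<partial>M) = ?b u * measure M {\<omega> \<in> space M. Z \<omega> \<le> u}"
        by simp
    qed
    finally show ?thesis .
  qed
  have joint: "(\<integral>\<omega>. (t - trunc_g t (X \<omega>)) * (t - trunc_g t (Y \<omega>)) \<partial>M)
      = (\<integral>p. ?b (fst p) * ?b (snd p) * H (fst p) (snd p) \<partial>(lborel \<Otimes>\<^sub>M lborel))"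
  proof -
    let ?k = "\<lambda>\<omega> p. ?b (fst p) * ?b (snd p) * (indicator {X \<omega>..} (fst p) * indicator {Y \<omega>..} (snd p))"
    have "(\<integral>\<omega>. (t - trunc_g t (X \<omega>)) * (t - trunc_g t (Y \<omega>)) \<partial>M)
       = (\<integral>\<omega>. \<integral>p. ?k \<omega> p \<partial>(lborel \<Otimes>\<^sub>M lborel) \<partial>M)"
    proof (intro Bochner_Integration.integral_cong refl)
      fix \<omega>
      have "(\<integral>p. ?k \<omega> p \<partial>(lborel \<Otimes>\<^sub>M lborel)) = (\<integral>u. \<integral>v. ?k \<omega> (u, v) \<partial>lborel \<partial>lborel)"
        by (intro lborel_pair.integral_fst'[symmetric] bound) (auto split: split_indicator)
      also have "\<dots> = (\<integral>u. \<integral>v. (?b u * indicator {X \<omega>..} u) * (?b v * indicator {Y \<omega>..} v) \<partial>lborel \<partial>lborel)"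
        by (simp add: mult_ac)
      also have "\<dots> = (t - trunc_g t (X \<omega>)) * (t - trunc_g t (Y \<omega>))"
        using t by (simp add: trunc_g_eq_integral)
      finally show "(t - trunc_g t (X \<omega>)) * (t - trunc_g t (Y \<omega>)) = (\<integral>p. ?k \<omega> p \<partial>(lborel \<Otimes>\<^sub>M lborel))" ..
    qed
    also have "\<dots> = (\<integral>p. \<integral>\<omega>. ?k \<omega> p \<partial>M \<partial>(lborel \<Otimes>\<^sub>M lborel))"
    proof (rule LLM.Fubini_integral[symmetric], unfold split_beta')
      show "integrable (M \<Otimes>\<^sub>M (lborel \<Otimes>\<^sub>M lborel)) (\<lambda>x. ?k (fst x) (snd x))"
      proof (rule Bochner_Integration.integrable_bound)
        show "integrable (M \<Otimes>\<^sub>M (lborel \<Otimes>\<^sub>M lborel)) (indicator (space M \<times> ({-t..t} \<times> {-t..t})) :: 'a \<times> real \<times> real \<Rightarrow> real)"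
          using box by (intro integrable_real_indicator)
             (auto simp: lborel_pair.P.emeasure_pair_measure_Times emeasure_space_1)
        show "AE x in M \<Otimes>\<^sub>M (lborel \<Otimes>\<^sub>M lborel). norm (?k (fst x) (snd x))
          \<le> norm (indicator (space M \<times> ({-t..t} \<times> {-t..t})) x :: real)"
          by (auto split: split_indicator simp: indicator_def space_pair_measure)
      qed (unfold indicator_def atLeast_iff, measurable)
    qed
    also have "\<dots> = (\<integral>p. ?b (fst p) * ?b (snd p) * H (fst p) (snd p) \<partial>(lborel \<Otimes>\<^sub>M lborel))"
    proof (intro Bochner_Integration.integral_cong refl)
      fix p :: "real \<times> real"
      have "(\<integral>\<omega>. ?k \<omega> p \<partial>M) = (\<integral>\<omega>. (?b (fst p) * ?b (snd p)) *
          indicator {\<omega> \<in> space M. X \<omega> \<le> fst p \<and> Y \<omega> \<le> snd p} \<omega> \<partial>M)"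
        by (intro Bochner_Integration.integral_cong) (auto split: split_indicator)
      then show "(\<integral>\<omega>. ?k \<omega> p \<partial>M) = ?b (fst p) * ?b (snd p) * H (fst p) (snd p)"
        by (simp add: H_def)
    qed
    finally show ?thesis .
  qed
  have prod: "(t - (\<integral>\<omega>. trunc_g t (X \<omega>) \<partial>M)) * (t - (\<integral>\<omega>. trunc_g t (Y \<omega>) \<partial>M))
      = (\<integral>p. ?b (fst p) * ?b (snd p) * (F (fst p) * G (snd p)) \<partial>(lborel \<Otimes>\<^sub>M lborel))"
  proof -
    have "(\<integral>p. ?b (fst p) * ?b (snd p) * (F (fst p) * G (snd p)) \<partial>(lborel \<Otimes>\<^sub>M lborel))
      = (\<integral>u. \<integral>v. ?b (fst (u, v)) * ?b (snd (u, v)) * (F (fst (u, v)) * G (snd (u, v))) \<partial>lborel \<partial>lborel)"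
      by (rule lborel_pair.integral_fst'[OF iFG, symmetric])
    also have "\<dots> = (\<integral>u. \<integral>v. (?b u * F u) * (?b v * G v) \<partial>lborel \<partial>lborel)"
      by (simp add: mult_ac)
    also have "\<dots> = (t - (\<integral>\<omega>. trunc_g t (X \<omega>) \<partial>M)) * (t - (\<integral>\<omega>. trunc_g t (Y \<omega>) \<partial>M))"
      by (simp add: marg F_def G_def)
    finally show ?thesis ..
  qed
  have iX: "integrable M (\<lambda>\<omega>. trunc_g t (X \<omega>))" and iY: "integrable M (\<lambda>\<omega>. trunc_g t (Y \<omega>))"
    using t by (auto intro!: integrable_const_bound[where B=t] abs_trunc_g_le)
  have iXY: "integrable M (\<lambda>\<omega>. trunc_g t (X \<omega>) * trunc_g t (Y \<omega>))"
    using t by (intro integrable_const_bound[where B="t * t"])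
      (auto simp: abs_mult intro!: abs_trunc_g_le mult_mono)
  have "(\<integral>\<omega>. (t - trunc_g t (X \<omega>)) * (t - trunc_g t (Y \<omega>)) \<partial>M)
    = t * t - t * (\<integral>\<omega>. trunc_g t (X \<omega>) \<partial>M) - t * (\<integral>\<omega>. trunc_g t (Y \<omega>) \<partial>M)
      + (\<integral>\<omega>. trunc_g t (X \<omega>) * trunc_g t (Y \<omega>) \<partial>M)"
    using iX iY iXY by (simp add: algebra_simps prob_space)
  then have "cov_trunc M X Y t = (\<integral>\<omega>. (t - trunc_g t (X \<omega>)) * (t - trunc_g t (Y \<omega>)) \<partial>M)
     - (t - (\<integral>\<omega>. trunc_g t (X \<omega>) \<partial>M)) * (t - (\<integral>\<omega>. trunc_g t (Y \<omega>) \<partial>M))"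
    by (simp add: cov_trunc_def algebra_simps)
  then show ?E unfolding joint prod eq
    using iH iFG by (simp add: Bochner_Integration.integral_diff)
qed

text \<open>Raising the level enlarges the box over which a nonnegative kernel is
  integrated.\<close>

lemma cov_trunc_nonneg_mono:
  assumes "prob_space M" and [measurable]: "X \<in> borel_measurable M" "Y \<in> borel_measurable M"
    and pqd: "\<And>x y. joint_excess M X Y x y \<ge> 0" and "0 \<le> s" "s \<le> t"
  shows "0 \<le> cov_trunc M X Y s" "cov_trunc M X Y s \<le> cov_trunc M X Y t"
proof -
  have "0 \<le> t" using assms by simp
  note h = hoeffding_cov_trunc[OF assms(1-3)]
  show "0 \<le> cov_trunc M X Y s"
    unfolding h(2)[OF \<open>0 \<le> s\<close>] using pqd by (intro Bochner_Integration.integral_nonneg) auto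
  show "cov_trunc M X Y s \<le> cov_trunc M X Y t"
    unfolding h(2)[OF \<open>0 \<le> s\<close>] h(2)[OF \<open>0 \<le> t\<close>]
    using pqd \<open>s \<le> t\<close>
    by (intro integral_mono h(1) \<open>0 \<le> s\<close> \<open>0 \<le> t\<close>) (auto split: split_indicator)
qed

text \<open>The \<open>lam j\<close> are controlled only for large j, so the range of integration
  may reach below 0, where the weight of the hypothesis can be negative. There clipping yields the
  constant -t, so the integrand vanishes.\<close>

lemma cov_trunc_nonpos:
  assumes "prob_space M" "t \<le> 0" shows "cov_trunc M X Y t = 0"
proof -
  interpret prob_space M by fact
  have "trunc_g t s = -t" for s using assms by (auto simp: trunc_g_def)
  then show ?thesis by (simp add: cov_trunc_def prob_space)
qed

section \<open>Dyadic truncation levels\<close>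

text \<open>On the block of indices up to \<^term>\<open>2 ^ m\<close> the variables are truncated at the level
  below. For large m it exceeds \<^term>\<open>lam j\<close> at all these indices because \<^prop>\<open>2 / p > 1\<close>, and the single factor
  \<^term>\<open>real m\<close> turns \<^term>\<open>2 powr (- 2 * real m / p)\<close> into the weight \<open>1 / (t Log t)\<^sup>2\<close>.\<close>

definition level :: "real \<Rightarrow> nat \<Rightarrow> real" where
  "level p m = 2 powr (real m / p) / real m"

lemma level_pos: "m \<ge> 1 \<Longrightarrow> level p m > 0"
  by (simp add: level_def)

lemma level_nonneg: "level p m \<ge> 0"
  by (simp add: level_def)

text \<open>The ratio is \<open>2 powr (1/p) * m / (m + 1)\<close>. Here p < 2 makes the first
  factor at least \<open>sqrt 2 \<ge> 7/5\<close>, and m \<ge> 6 makes the rest at least 6/7. This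
  is the origin of 6/5 and of the index shift by 6 in the sums over levels.\<close>

lemma level_growth:
  assumes "1 < p" "p < 2" "m \<ge> 6"
  shows "6 / 5 * level p m \<le> level p (Suc m)"
proof -
  have "(7/5 :: real) \<le> sqrt 2" by (rule real_le_rsqrt) (simp add: power2_eq_square)
  also have "\<dots> = 2 powr (1/2)" by (simp add: powr_half_sqrt)
  also have "\<dots> \<le> 2 powr (1/p)" using assms by (intro powr_mono) (auto simp: field_simps)
  finally have 1: "7/5 \<le> (2::real) powr (1/p)" .
  have 2: "6/7 * real (Suc m) \<le> real m" using assms by simp
  have "6/5 * real (Suc m) \<le> 7/5 * real m" using 2 by simp
  also have "\<dots> \<le> 2 powr (1/p) * real m" using 1 by (intro mult_right_mono) auto
  finally have 3: "6/5 * real (Suc m) \<le> 2 powr (1/p) * real m" .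
  have "2 powr (real (Suc m) / p) = 2 powr (1/p) * 2 powr (real m / p)"
    by (simp add: powr_add[symmetric] add_divide_distrib)
  then have "level p (Suc m) = (2 powr (1/p) * real m) * (2 powr (real m / p) / (real m * real (Suc m)))"
    using assms by (simp add: level_def del: of_nat_Suc)
  moreover have "6/5 * level p m = (6/5 * real (Suc m)) * (2 powr (real m / p) / (real m * real (Suc m)))"
    using assms by (simp add: level_def field_simps del: of_nat_Suc)
  ultimately show ?thesis using 3 by (simp only:) (intro mult_right_mono, auto)
qed

lemma level_Suc_le:
  assumes "1 < p" "m \<ge> 1"
  shows "level p (Suc m) \<le> 2 * level p m"
proof -
  have "(2::real) powr (1/p) \<le> 2 powr 1" using assms by (intro powr_mono) auto
  then have "2 powr (1/p) * 2 powr (real m / p) \<le> 2 * 2 powr (real m / p)"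
    by (intro mult_right_mono) auto
  then have "2 powr (real (Suc m) / p) \<le> 2 * 2 powr (real m / p)"
    by (simp add: powr_add[symmetric] add_divide_distrib)
  then show ?thesis using assms unfolding level_def
    using frac_le[of "2 * 2 powr (real m / p)" "2 powr (real (Suc m) / p)" "real m" "real (Suc m)"] by simp
qed

lemma level_mono:
  assumes "1 < p" "p < 2" "6 \<le> m" "m \<le> n"
  shows "level p m \<le> level p n"
  using assms(4)
proof (induction n rule: dec_induct)
  case base then show ?case by simp
next
  case (step n)
  have "level p n \<le> 6 / 5 * level p n" using level_pos[of n p] step assms by simp
  also have "\<dots> \<le> level p (Suc n)" using level_growth[of p n] step assms by simp
  finally show ?case using step by simp
qed

text \<open>The left side is the number of indices in a block over the squared power of the norming
  sequence. It agrees with the right side up to the factor \<open>m powr (2 - p) \<ge> 1\<close>;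
  expressed through the level alone, it makes sums over m geometric.\<close>

lemma level_powr:
  assumes "1 < p" "p < 2" "m \<ge> 1"
  shows "2 ^ m / (2 powr (real m / p))\<^sup>2 \<le> level p m powr (p - 2)"
proof -
  have "level p m powr (p - 2) = 2 powr (real m / p * (p - 2)) * real m powr (2 - p)"
    using powr_minus_divide[of "real m" "p - 2"] by (simp add: level_def powr_divide powr_powr)
  also have "2 powr (real m / p * (p - 2)) = 2 powr (real m - (real m / p + real m / p))"
    using assms by (intro arg_cong2[where f="(powr)"]) (auto simp: field_simps)
  also have "\<dots> = 2 ^ m / (2 powr (real m / p))\<^sup>2"
    by (simp only: powr_diff powr_add) (simp add: power2_eq_square powr_realpow)
  finally have e: "level p m powr (p - 2) = 2 ^ m / (2 powr (real m / p))\<^sup>2 * real m powr (2 - p)" .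
  have "1 \<le> real m powr (2 - p)" using assms by (intro ge_one_powr_ge_zero) auto
  then have "2 ^ m / (2 powr (real m / p))\<^sup>2 * 1 \<le> 2 ^ m / (2 powr (real m / p))\<^sup>2 * real m powr (2 - p)"
    by (intro mult_left_mono) auto
  then show ?thesis using e by simp
qed

lemma Log_level_le:
  assumes "1 < p" "m \<ge> 1" "t \<le> level p m" "0 < t"
  shows "Log t \<le> real m"
proof -
  have "level p m \<le> 2 powr (real m / p)" using assms by (simp add: level_def divide_le_eq)
  also have "\<dots> \<le> 2 powr (real m)" using assms by (intro powr_mono) (auto simp: field_simps)
  also have "\<dots> \<le> exp 1 powr real m"
    using exp_ge_add_one_self[of 1] by (intro powr_mono2) auto
  also have "\<dots> = exp (real m)" by (simp add: powr_def)
  finally have "t \<le> exp (real m)" using assms by simp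
  moreover have "exp 1 \<le> exp (real m)" using assms by simp
  ultimately have le: "max \<bar>t\<bar> (exp 1) \<le> exp (real m)" using assms by simp
  have "0 < max \<bar>t\<bar> (exp 1)" by (rule less_le_trans[OF exp_gt_zero max.cobounded2])
  from iffD2[OF ln_le_cancel_iff[OF this exp_gt_zero] le] show ?thesis by (simp add: Log_def)
qed

lemma Log_ge_1: "1 \<le> Log t"
proof -
  have pos: "0 < max \<bar>t\<bar> (exp 1)" by (rule less_le_trans[OF exp_gt_zero max.cobounded2])
  show ?thesis unfolding Log_def using ln_ge_iff[OF pos, of 1] by simp
qed

section \<open>Sums over the levels for a fixed value\<close>

text \<open>To be integrated at \<open>v = Y \<omega>\<close>, hence K is uniform in v and N. With c
  the level, the terms with c \<le> |v| are at most \<open>c powr p\<close> and increase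
  geometrically; the others are at most \<open>c powr (p - 2) * v\<^sup>2\<close> and decrease, as p
  < 2. Both series are dominated by their terms near c = |v|, that is by
  \<open>\<bar>v\<bar> powr p\<close>; dividing the levels by |v| puts the transition at 1.\<close>

lemma sum_truncated_square_le:
  assumes p: "1 < p" "p < 2"
  shows "\<exists>K. \<forall>v N. (\<Sum>i<N. 2 ^ (i + 6) / (2 powr (real (i + 6) / p))\<^sup>2 * min (v\<^sup>2) ((level p (i + 6))\<^sup>2))
     \<le> K * \<bar>v\<bar> powr p"
proof (intro exI allI)
  define K1 where "K1 = (6/5) powr p / ((6/5) powr p - 1 :: real)"
  define K2 where "K2 = (6/5) powr (2 - p) / ((6/5) powr (2 - p) - 1 :: real)"
  let ?c = "\<lambda>i. level p (i + 6)" and ?w = "\<lambda>i. 2 ^ (i + 6) / (2 powr (real (i + 6) / p))\<^sup>2 :: real"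
  fix v :: real and N :: nat
  show "(\<Sum>i<N. ?w i * min (v\<^sup>2) ((?c i)\<^sup>2)) \<le> (K1 + K2) * \<bar>v\<bar> powr p"
  proof (cases "v = 0")
    case True then show ?thesis by simp
  next
    case False
    define u where "u = \<bar>v\<bar>"
    have u: "u > 0" "v\<^sup>2 = u\<^sup>2" using False by (auto simp: u_def)
    define d where "d i = ?c i / u" for i
    have c: "?c i > 0" for i by (intro level_pos) simp
    have d: "d i > 0" for i using c u by (simp add: d_def)
    have g: "6/5 * d i \<le> d (Suc i)" for i
      using divide_right_mono[OF level_growth[OF p, of "i + 6"], of u] u by (simp add: d_def)
    have summand: "?w i * min (v\<^sup>2) ((?c i)\<^sup>2) \<le>
      u powr p * (if d i \<le> 1 then d i powr p else 0) + u powr p * (if d i \<ge> 1 then d i powr (-(2 - p)) else 0)" for i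
    proof -
      have w: "?w i \<le> ?c i powr (p - 2)" using p by (intro level_powr) auto
      have ce: "?c i = d i * u" using u by (simp add: d_def)
      have pw: "x powr (p - 2) * x\<^sup>2 = x powr p" if "x > 0" for x :: real
        using that by (simp add: powr_diff powr_numeral field_simps)
      show ?thesis
      proof (cases "d i \<le> 1")
        case True
        have "?w i * min (v\<^sup>2) ((?c i)\<^sup>2) \<le> ?c i powr (p - 2) * (?c i)\<^sup>2"
          using w by (intro mult_mono) auto
        also have "\<dots> = u powr p * d i powr p" using c[of i] u d[of i] pw[of "?c i"]
          by (simp add: ce powr_mult mult_ac)
        finally show ?thesis using True by (simp add: add_increasing2)
      next
        case False
        have "?w i * min (v\<^sup>2) ((?c i)\<^sup>2) \<le> ?c i powr (p - 2) * u\<^sup>2"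
          using w u by (intro mult_mono) auto
        also have "\<dots> = (u powr (p - 2) * u\<^sup>2) * d i powr (p - 2)"
          using u d[of i] by (simp add: ce powr_mult mult_ac)
        also have "\<dots> = u powr p * d i powr (-(2 - p))" using pw[OF u(1)] by simp
        finally show ?thesis using False by simp
      qed
    qed
    have "(\<Sum>i<N. ?w i * min (v\<^sup>2) ((?c i)\<^sup>2)) \<le>
       u powr p * (\<Sum>i<N. if d i \<le> 1 then d i powr p else 0)
       + u powr p * (\<Sum>i<N. if d i \<ge> 1 then d i powr (-(2 - p)) else 0)"
      unfolding sum_distrib_left sum.distrib[symmetric] by (intro sum_mono summand)
    also have "\<dots> \<le> u powr p * K1 + u powr p * K2"
      unfolding K1_def K2_def using d g p
      by (intro add_mono mult_left_mono geometric_sum_below_one geometric_sum_above_one) auto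
    finally show ?thesis by (simp add: u_def algebra_simps)
  qed
qed

text \<open>Only levels c below |v| contribute. There the excess is at most |v| and the weight at
  most \<open>c powr (p - 1)\<close>, a geometrically increasing sequence because p > 1, so the
  total is of order \<open>\<bar>v\<bar> powr (p - 1) * \<bar>v\<bar>\<close>.\<close>

lemma sum_excess_le:
  assumes p: "1 < p" "p < 2"
  shows "\<exists>K. \<forall>v N. (\<Sum>i<N. 2 ^ (i + 6) / (2 powr (real (i + 6) / p) * real (i + 6)) * max (\<bar>v\<bar> - level p (i + 6)) 0)
     \<le> K * \<bar>v\<bar> powr p"
proof (intro exI allI)
  define K where "K = (6/5) powr (p - 1) / ((6/5) powr (p - 1) - 1 :: real)"
  let ?c = "\<lambda>i. level p (i + 6)" and ?w = "\<lambda>i. 2 ^ (i + 6) / (2 powr (real (i + 6) / p) * real (i + 6)) :: real"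
  fix v :: real and N :: nat
  show "(\<Sum>i<N. ?w i * max (\<bar>v\<bar> - ?c i) 0) \<le> K * \<bar>v\<bar> powr p"
  proof (cases "v = 0")
    case True
    then show ?thesis using level_pos[of _ p] by (simp add: max_def not_le sum_nonpos less_imp_le)
  next
    case False
    define u where "u = \<bar>v\<bar>"
    have u: "u > 0" using False by (auto simp: u_def)
    define d where "d i = ?c i / u" for i
    have c: "?c i > 0" for i by (intro level_pos) simp
    have d: "d i > 0" for i using c u by (simp add: d_def)
    have g: "6/5 * d i \<le> d (Suc i)" for i
      using divide_right_mono[OF level_growth[OF p, of "i + 6"], of u] u by (simp add: d_def)
    have summand: "?w i * max (u - ?c i) 0 \<le> u powr p * (if d i \<le> 1 then d i powr (p - 1) else 0)" for i
    proof (cases "d i \<le> 1")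
      case True
      have ce: "?c i = d i * u" using u by (simp add: d_def)
      have "?w i = 2 ^ (i + 6) / (2 powr (real (i + 6) / p))\<^sup>2 * ?c i"
        by (simp add: level_def power2_eq_square)
      also have "\<dots> \<le> ?c i powr (p - 2) * ?c i"
        using p c[of i] by (intro mult_right_mono level_powr) auto
      also have "\<dots> = ?c i powr (p - 1)"
        using c[of i] powr_add[of "?c i" "p - 2" 1] by simp
      finally have w: "?w i \<le> ?c i powr (p - 1)" .
      have "?w i * max (u - ?c i) 0 \<le> ?c i powr (p - 1) * u"
        using w u c[of i] by (intro mult_mono) auto
      also have "\<dots> = d i powr (p - 1) * (u powr (p - 1) * u powr 1)"
        using u d[of i] by (simp add: ce powr_mult)
      also have "u powr (p - 1) * u powr 1 = u powr p"
        by (subst powr_add[symmetric]) simp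
      finally show ?thesis using True by (simp add: mult_ac)
    next
      case False
      then have "?c i \<ge> u" using u by (simp add: d_def field_simps)
      then show ?thesis using False by simp
    qed
    have "(\<Sum>i<N. ?w i * max (u - ?c i) 0) \<le> u powr p * (\<Sum>i<N. if d i \<le> 1 then d i powr (p - 1) else 0)"
      unfolding sum_distrib_left by (intro sum_mono summand)
    also have "\<dots> \<le> u powr p * K"
      unfolding K_def using d g p by (intro mult_left_mono geometric_sum_below_one) auto
    finally show ?thesis by (simp add: u_def mult_ac)
  qed
qed

lemma summable_integral_of_sum_le:
  fixes f :: "nat \<Rightarrow> 'a \<Rightarrow> real"
  assumes "\<And>i. integrable M (f i)" "\<And>i \<omega>. f i \<omega> \<ge> 0" "integrable M g"
    and "\<And>N \<omega>. (\<Sum>i<N. f i \<omega>) \<le> g \<omega>"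
  shows "summable (\<lambda>i. \<integral>\<omega>. f i \<omega> \<partial>M)"
proof (rule summableI_nonneg_bounded)
  fix N
  have "(\<Sum>i<N. \<integral>\<omega>. f i \<omega> \<partial>M) = (\<integral>\<omega>. (\<Sum>i<N. f i \<omega>) \<partial>M)"
    using assms by (simp add: Bochner_Integration.integral_sum)
  also have "\<dots> \<le> (\<integral>\<omega>. g \<omega> \<partial>M)" using assms by (intro integral_mono) auto
  finally show "(\<Sum>i<N. \<integral>\<omega>. f i \<omega> \<partial>M) \<le> (\<integral>\<omega>. g \<omega> \<partial>M)" .
qed (use assms in auto)

section \<open>Lower limits of the integrals against the levels\<close>

text \<open>Checking j = 2 ^ m is not enough: the claim is uniform in j, and for j much smaller than
  2 ^ m the logarithm in the denominator is too small to help. There the power of j itself leaves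
  room.\<close>

lemma eventually_le_level:
  fixes lam :: "nat \<Rightarrow> real"
  assumes p: "1 < p" "p < 2" and "C > 0"
    and lam: "(\<lambda>j. lam j - C * (real j powr (1/p) / Log (real j) powr (2/p)))
           \<in> o(\<lambda>j. real j powr (1/p) / Log (real j) powr (2/p))"
  shows "\<forall>\<^sub>F m in sequentially. \<forall>j\<ge>1. j \<le> 2 ^ m \<longrightarrow> lam j \<le> level p m"
proof -
  define w where "w j = real j powr (1/p) / Log (real j) powr (2/p)" for j
  have w0: "w j \<ge> 0" for j by (simp add: w_def)
  have "\<forall>\<^sub>F j in sequentially. norm (lam j - C * w j) \<le> C * norm (w j)"
    using landau_o.smallD[OF lam \<open>C > 0\<close>] by (simp add: w_def)
  then obtain J where J: "\<And>j. j \<ge> J \<Longrightarrow> norm (lam j - C * w j) \<le> C * norm (w j)"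
    unfolding eventually_sequentially by blast
  have J: "lam j \<le> 2 * C * w j" if "j \<ge> J" for j
    using J[OF that] w0[of j] by (simp add: abs_le_iff)
  \<comment> \<open>Finitely many early j escape the asymptotics; one constant bounds them all, and
    the levels tend to infinity.\<close>
  define \<Lambda> where "\<Lambda> = (\<Sum>j<J. \<bar>lam j\<bar>)"
  have \<Lambda>: "lam j \<le> \<Lambda>" if "j < J" for j
    using member_le_sum[of j "{..<J}" "\<lambda>j. \<bar>lam j\<bar>"] that by (simp add: \<Lambda>_def)
  define q where "q = 1 / p"
  have q: "1/2 < q" "q < 1" using p by (auto simp: q_def field_simps)
  have lev: "2 powr (real m / 2) / real m \<le> level p m" for m
  proof -
    have "real m * (1 / 2) \<le> real m * (1 / p)" using q by (intro mult_left_mono) (auto simp: q_def)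
    then show ?thesis by (auto simp: level_def intro!: divide_right_mono powr_mono)
  qed
  \<comment> \<open>One estimate for each range of j: below J, up to \<open>2 powr (m / 2)\<close>,
    and beyond. The third one holds because \<open>2 * q > 1\<close>.\<close>
  have "\<forall>\<^sub>F m in sequentially. \<Lambda> \<le> 2 powr (real m / 2) / real m" by real_asymp
  moreover have "\<forall>\<^sub>F m in sequentially. 2 * C * real m \<le> 2 powr (real m / 4)" by real_asymp
  moreover have "\<forall>\<^sub>F m in sequentially. 2 * C * real m * (real m / 3) powr (- (2 * q)) \<le> 1"
  proof -
    have "((\<lambda>m. 2 * C * 3 powr (2 * q) * real m powr (1 - 2 * q)) \<longlongrightarrow> 2 * C * 3 powr (2 * q) * 0) sequentially"
      using q by (intro tendsto_mult tendsto_const tendsto_neg_powr filterlim_real_sequentially) auto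
    then have "\<forall>\<^sub>F m in sequentially. 2 * C * 3 powr (2 * q) * real m powr (1 - 2 * q) < 1"
      by (intro order_tendstoD(2)) auto
    then show ?thesis
    proof eventually_elim
      case (elim m)
      have "real m * (real m / 3) powr (- (2 * q)) = 3 powr (2 * q) * real m powr (1 - 2 * q)"
        by (cases "m = 0") (auto simp: powr_divide powr_diff powr_minus field_simps)
      then show ?case using elim by (simp add: mult.assoc)
    qed
  qed
  ultimately show ?thesis using eventually_ge_at_top[of 1]
  proof eventually_elim
    case (elim m)
    show ?case
    proof (intro allI impI)
      fix j :: nat assume j: "1 \<le> j" "j \<le> 2 ^ m"
      show "lam j \<le> level p m"
      proof (cases "j < J")
        case True
        then show ?thesis using \<Lambda>[of j] elim(1) lev[of m] by simp
      next
        case False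
        then have l: "lam j \<le> 2 * C * w j" using J by simp
        have split: "2 powr (real m / p) = 2 powr (real m * q)" by (simp add: q_def)
        have jm: "real j \<le> 2 powr real m" using j by (simp add: powr_realpow)
        \<comment> \<open>In the lower half of the exponents \<open>w j\<close> is at most
          \<open>2 powr (m * q / 2)\<close>, and the other half of the power pays for the factor
          \<open>2 * C * m\<close>. In the upper half \<open>ln 2 \<ge> 2/3\<close> gives
          \<open>Log j \<ge> m / 3\<close>, whose power 2 q exceeds m by a growing factor.\<close>
        show ?thesis
        proof (cases "real j \<le> 2 powr (real m / 2)")
          case True
          have "w j \<le> real j powr q / 1"
            unfolding w_def q_def using Log_ge_1[of "real j"] p
            by (intro divide_left_mono) (auto intro!: ge_one_powr_ge_zero)
          also have "\<dots> \<le> (2 powr (real m / 2)) powr q" using True q by (simp add: powr_mono2)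
          also have "\<dots> = 2 powr (real m * q / 2)" by (simp add: powr_powr)
          finally have "lam j \<le> 2 * C * 2 powr (real m * q / 2)"
            using l \<open>C > 0\<close> by (smt (verit) mult_left_mono)
          then have "lam j * real m \<le> (2 * C * real m) * 2 powr (real m * q / 2)"
            using mult_right_mono[of "lam j" "2 * C * 2 powr (real m * q / 2)" "real m"] by (simp add: mult_ac)
          also have "\<dots> \<le> 2 powr (real m / 4) * 2 powr (real m * q / 2)"
            using elim by (intro mult_right_mono) auto
          also have "\<dots> \<le> 2 powr (real m * q / 2) * 2 powr (real m * q / 2)"
            using mult_left_mono[of "1/2" q "real m"] q by (intro mult_right_mono powr_mono) auto
          also have "\<dots> = 2 powr (real m * q)" by (simp add: powr_add[symmetric] mult.commute)
          finally show ?thesis using elim(4) by (simp add: level_def split le_divide_eq)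
        next
          case False
          have "real m / 3 \<le> real m / 2 * ln 2" using mult_left_mono[OF ln2_ge_two_thirds, of "real m / 2"] by simp
          also have "\<dots> = ln (2 powr (real m / 2))" by (simp add: ln_powr)
          also have "\<dots> \<le> ln (real j)" using False j by (subst ln_le_cancel_iff) auto
          also have "\<dots> \<le> Log (real j)" unfolding Log_def using j by (subst ln_le_cancel_iff) auto
          finally have L: "real m / 3 \<le> Log (real j)" .
          have "w j = real j powr q * Log (real j) powr (- (2 * q))"
            by (simp add: w_def q_def powr_minus divide_inverse)
          also have "\<dots> \<le> 2 powr (real m * q) * (real m / 3) powr (- (2 * q))"
          proof (intro mult_mono)
            show "real j powr q \<le> 2 powr (real m * q)"
              using jm q powr_mono2[of q "real j" "2 powr real m"] by (simp add: powr_powr)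
            show "Log (real j) powr (- (2 * q)) \<le> (real m / 3) powr (- (2 * q))"
              using L q elim by (intro powr_mono2') auto
          qed auto
          finally have "lam j \<le> 2 * C * (2 powr (real m * q) * (real m / 3) powr (- (2 * q)))"
            using l \<open>C > 0\<close> by (smt (verit) mult_left_mono)
          then have "lam j * real m \<le> 2 * C * (2 powr (real m * q) * (real m / 3) powr (- (2 * q))) * real m"
            by (intro mult_right_mono) auto
          also have "\<dots> = 2 powr (real m * q) * (2 * C * real m * (real m / 3) powr (- (2 * q)))"
            by (simp add: mult_ac)
          also have "\<dots> \<le> 2 powr (real m * q) * 1" using elim by (intro mult_left_mono) auto
          finally show ?thesis using elim(4) by (simp add: level_def split le_divide_eq)
        qed
      qed
    qed
  qed
qed

section \<open>From values at the levels to the integral\<close>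

definition weight :: "real \<Rightarrow> real" where
  "weight t = 1 / (t ^ 3 * Log t ^ 2) + 1 / (max t (exp 1) * t ^ 2 * Log t ^ 3)"

text \<open>An integral test along the levels: the intervals between consecutive levels are disjoint
  and lie above l. As G increases, its value at the left end is a lower bound on the whole interval,
  while t and \<open>Log t\<close> change there by bounded factors only.\<close>

lemma sum_at_levels_le_integral:
  assumes p: "1 < p" "p < 2" and "finite A"
    and A: "\<And>m. m \<in> A \<Longrightarrow> 6 \<le> m \<and> l \<le> level p m"
    and mono: "\<And>s t. 0 \<le> s \<Longrightarrow> s \<le> t \<Longrightarrow> G s \<le> G t" and nonneg: "\<And>t. 0 \<le> G t" and zero: "\<And>t. t \<le> 0 \<Longrightarrow> G t = 0"
    and int: "set_integrable lborel {l..} (\<lambda>t. weight t * G t)"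
  shows "(\<Sum>m\<in>A. G (level p m) / (2 powr (real m / p))\<^sup>2) \<le> 160 * (LINT t:{l..}|lborel. weight t * G t)"
proof -
  let ?c = "level p"
  let ?I = "\<lambda>m. {?c m..<?c (Suc m)}"
  \<comment> \<open>The height of the rectangle over \<open>?I m\<close> whose area is the summand
    for m, so that the comparison becomes pointwise in t.\<close>
  define h where "h m = G (?c m) / (2 powr (real m / p))\<^sup>2 / (?c (Suc m) - ?c m)" for m
  have wG: "0 \<le> weight t * G t" for t
  proof (cases "t \<le> 0")
    case False
    then show ?thesis using nonneg[of t] Log_ge_1[of t]
      by (intro mult_nonneg_nonneg) (auto simp: weight_def intro!: add_nonneg_nonneg divide_nonneg_nonneg mult_nonneg_nonneg)
  qed (simp add: zero)
  have disj: "disjoint_family_on ?I A"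
    unfolding disjoint_family_on_def
  proof (intro ballI impI)
    fix m n assume "m \<in> A" "n \<in> A" "m \<noteq> n"
    then consider "Suc m \<le> n" "6 \<le> m" | "Suc n \<le> m" "6 \<le> n" using A by force
    then show "?I m \<inter> ?I n = {}"
    proof cases
      case 1
      then show ?thesis using level_mono[OF p, of "Suc m" n] by auto
    next
      case 2
      then show ?thesis using level_mono[OF p, of "Suc n" m] by auto
    qed
  qed
  have gap: "0 < ?c m" "1/5 * ?c m \<le> ?c (Suc m) - ?c m" if "m \<ge> 6" for m
    using level_growth[OF p that] level_pos[of m p] that by auto
  \<comment> \<open>The constant: \<open>160 = 5 * 2 ^ 3 * 2\<^sup>2\<close>, from the gap, from \<open>t \<le> 2 * level p m\<close>, and from \<open>Log t \<le> 2 * m\<close>.\<close>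
  have low: "h m \<le> 160 * (weight t * G t)" if m: "m \<in> A" and t: "t \<in> ?I m" for m t
  proof -
    have m6: "m \<ge> 6" using A m by auto
    note g = gap[OF m6]
    have t0: "t > 0" "?c m \<le> t" "t \<le> 2 * ?c m"
      using t g level_Suc_le[of p m] p m6 by auto
    have Lt: "Log t \<le> real (Suc m)" using p t t0 by (intro Log_level_le[of p]) auto
    then have Lt2: "Log t \<le> 2 * real m" using m6 by simp
    have Gt: "G (?c m) \<le> G t" using g t by (intro mono) auto
    have e: "(2 powr (real m / p))\<^sup>2 = (?c m)\<^sup>2 * (real m)\<^sup>2" using m6 by (simp add: level_def power_divide)
    have "h m = G (?c m) / ((?c m)\<^sup>2 * (real m)\<^sup>2 * (?c (Suc m) - ?c m))"
      by (simp add: h_def e)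
    also have "\<dots> \<le> G t / ((?c m)\<^sup>2 * (real m)\<^sup>2 * (1/5 * ?c m))"
      using Gt nonneg g m6 by (intro frac_le mult_left_mono) auto
    also have "\<dots> = 160 * (G t / ((2 * ?c m) ^ 3 * (2 * real m)\<^sup>2))"
      by (simp add: power2_eq_square power3_eq_cube mult_ac)
    also have "\<dots> \<le> 160 * (G t / (t ^ 3 * (Log t)\<^sup>2))"
      using nonneg t0 Lt2 Log_ge_1[of t] m6
      by (intro mult_left_mono divide_left_mono mult_mono power_mono) auto
    also have "\<dots> \<le> 160 * (weight t * G t)"
    proof -
      have "1 / (t ^ 3 * (Log t)\<^sup>2) \<le> weight t"
        using t0 Log_ge_1[of t] by (simp add: weight_def)
      then show ?thesis using nonneg[of t] mult_right_mono[of "1 / (t ^ 3 * (Log t)\<^sup>2)" "weight t" "G t"] by simp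
    qed
    finally show ?thesis .
  qed
  have one: "G (?c m) / (2 powr (real m / p))\<^sup>2 = (\<integral>t. indicator (?I m) t * h m \<partial>lborel)"
    if "m \<in> A" for m
  proof -
    have "?c m < ?c (Suc m)" using gap[of m] A[OF that] by auto
    then show ?thesis by (simp add: h_def)
  qed
  have inth: "integrable lborel (\<lambda>t. indicator (?I m) t * h m)" if "m \<in> A" for m
  proof -
    have "?c m < ?c (Suc m)" using gap[of m] A[OF that] by auto
    then show ?thesis by (intro integrable_mult_left integrable_real_indicator) auto
  qed
  have "(\<Sum>m\<in>A. G (?c m) / (2 powr (real m / p))\<^sup>2) = (\<integral>t. (\<Sum>m\<in>A. indicator (?I m) t * h m) \<partial>lborel)"
    using one inth by (simp add: Bochner_Integration.integral_sum)
  also have "\<dots> \<le> (\<integral>t. 160 * (indicator {l..} t *\<^sub>R (weight t * G t)) \<partial>lborel)"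
  proof (rule integral_mono)
    show "integrable lborel (\<lambda>t. \<Sum>m\<in>A. indicator (?I m) t * h m)"
      using inth by (intro Bochner_Integration.integrable_sum)
    show "integrable lborel (\<lambda>t. 160 * (indicator {l..} t *\<^sub>R (weight t * G t)))"
      using int unfolding set_integrable_def by (intro integrable_mult_right)
    fix t
    have un: "indicat_real (\<Union>m\<in>A. ?I m) t = (\<Sum>m\<in>A. indicator (?I m) t)"
      by (rule indicator_UN_disjoint[OF \<open>finite A\<close> disj])
    have "(\<Sum>m\<in>A. indicator (?I m) t * h m) \<le> (\<Sum>m\<in>A. indicator (?I m) t * (160 * (weight t * G t)))"
      using low by (intro sum_mono) (auto split: split_indicator)
    also have "\<dots> = indicator (\<Union>m\<in>A. ?I m) t * (160 * (weight t * G t))"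
      by (simp add: un sum_distrib_right)
    also have "\<dots> \<le> indicator {l..} t * (160 * (weight t * G t))"
      using wG[of t] A by (intro mult_right_mono) (force split: split_indicator)+
    finally show "(\<Sum>m\<in>A. indicator (?I m) t * h m) \<le> 160 * (indicator {l..} t *\<^sub>R (weight t * G t))"
      by simp
  qed
  finally show ?thesis by (simp add: set_lebesgue_integral_def)
qed

lemma double_sum_symmetric:
  fixes f :: "nat \<Rightarrow> nat \<Rightarrow> real"
  assumes "\<And>k j. f k j = f j k"
  shows "(\<Sum>k<n. \<Sum>j<n. f k j) = (\<Sum>k<n. f k k) + 2 * (\<Sum>j<n. \<Sum>k<j. f k j)"
proof (induction n)
  case 0 then show ?case by simp
next
  case (Suc n)
  have "(\<Sum>j<n. f n j) = (\<Sum>k<n. f k n)" using assms by (intro sum.cong) auto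
  then show ?case using Suc by (simp add: sum.distrib)
qed

lemma tendsto_of_dyadic_bound:
  fixes S T :: "nat \<Rightarrow> real"
  assumes p: "1 < p"
    and bound: "\<And>m n. n < 2 ^ m \<Longrightarrow> \<bar>S n\<bar> \<le> T m"
    and T: "(\<lambda>m. T m / (2 powr (real m / p) * real m)) \<longlonglongrightarrow> 0"
  shows "(\<lambda>n. S n / (real n powr (1/p) * Log (real n))) \<longlonglongrightarrow> 0"
proof (rule LIMSEQ_I)
  fix e :: real assume e: "e > 0"
  \<comment> \<open>8 = 2 * 4 bounds the ratio of the norming constants at the next power of two and
    at n: 2 from \<open>2 powr (1/p) \<le> 2\<close>, and 4 from \<open>m \<le> 2 * q\<close>
    together with \<open>ln 2 \<ge> 1/2\<close>.\<close>
  then obtain m1 where m1: "\<And>m. m \<ge> m1 \<Longrightarrow> \<bar>T m / (2 powr (real m / p) * real m)\<bar> < e / 8"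
    using LIMSEQ_D[OF T, of "e / 8"] by auto
  \<comment> \<open>Starting at \<open>2 ^ Suc m1\<close> forces q > m1, hence q \<ge> 1, without
    which \<open>Suc q \<le> 2 * q\<close> would fail.\<close>
  have "norm (S n / (real n powr (1/p) * Log (real n)) - 0) < e" if n: "n \<ge> 2 ^ Suc m1" for n
  proof -
    have n2: "n \<ge> 1" using n by (metis one_le_numeral one_le_power order_trans)
    obtain q where q: "2 ^ q \<le> n" "n < 2 ^ Suc q" using ex_power_ivl1[of 2 n] n2 by auto
    have "(2::nat) ^ Suc m1 < 2 ^ Suc q" using n q by linarith
    then have qm: "m1 < q" by (simp add: power_strict_increasing_iff)
    define m where "m = Suc q"
    have m: "m \<ge> m1" "n < 2 ^ m" "m \<ge> 1" "real m \<le> 2 * real q" using qm q by (auto simp: m_def)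
    have rq: "2 powr real q \<le> real n" using q(1) by (simp add: powr_realpow)
    have "2 powr (real m / p) = 2 powr (1/p) * 2 powr (real q / p)"
      by (simp add: m_def powr_add[symmetric] add_divide_distrib)
    also have "\<dots> \<le> 2 powr 1 * 2 powr (real q / p)"
      using p by (intro mult_right_mono powr_mono) auto
    also have "\<dots> \<le> 2 * real n powr (1/p)"
      using rq p powr_mono2[of "1/p" "2 powr real q" "real n"] by (simp add: powr_powr)
    finally have A: "2 powr (real m / p) \<le> 2 * real n powr (1/p)" .
    have "real m / 4 \<le> real q * (1 / 2)" using m by simp
    also have "\<dots> \<le> real q * ln 2" using ln2_ge_two_thirds by (intro mult_left_mono) auto
    also have "\<dots> = ln (2 powr real q)" by (simp add: ln_powr)
    also have "\<dots> \<le> ln (real n)" using rq n2 by (subst ln_le_cancel_iff) auto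
    also have "\<dots> \<le> Log (real n)" unfolding Log_def using n2 by (subst ln_le_cancel_iff) auto
    finally have B: "real m / 4 \<le> Log (real n)" .
    have "2 powr (real m / p) * real m = 8 * ((2 powr (real m / p) / 2) * (real m / 4))" by simp
    also have "\<dots> \<le> 8 * (real n powr (1/p) * Log (real n))"
      using A B by (intro mult_left_mono mult_mono) auto
    finally have AB: "2 powr (real m / p) * real m / 8 \<le> real n powr (1/p) * Log (real n)" by simp
    have pos: "2 powr (real m / p) * real m > 0" using m by simp
    have T0: "0 \<le> T m" using bound[OF m(2)] by linarith
    have "\<bar>S n / (real n powr (1/p) * Log (real n))\<bar> \<le> T m / (2 powr (real m / p) * real m / 8)"
      using AB pos bound[OF m(2)] Log_ge_1[of "real n"] by (simp only: abs_divide) (intro frac_le, auto)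
    also have "\<dots> = 8 * (T m / (2 powr (real m / p) * real m))" by simp
    also have "\<dots> < e" using m1[OF m(1)] by linarith
    finally show ?thesis by simp
  qed
  then show "\<exists>n0. \<forall>n\<ge>n0. norm (S n / (real n powr (1/p) * Log (real n)) - 0) < e" by blast
qed

section \<open>The strong law\<close>

lemma trunc_g_square:
  assumes "t \<ge> 0"
  shows "(trunc_g t s)\<^sup>2 = min (s\<^sup>2) (t\<^sup>2)"
proof -
  have "\<bar>trunc_g t s\<bar> = min \<bar>s\<bar> t" using assms by (auto simp: trunc_g_def)
  then have "(trunc_g t s)\<^sup>2 = (min \<bar>s\<bar> t)\<^sup>2" by (metis power2_abs)
  also have "\<dots> = min (s\<^sup>2) (t\<^sup>2)"
    using assms abs_le_square_iff[of s t] by (auto simp: min_def)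
  finally show ?thesis .
qed

lemma abs_diff_trunc_g: "t \<ge> 0 \<Longrightarrow> \<bar>s - trunc_g t s\<bar> = max (\<bar>s\<bar> - t) 0"
  by (auto simp: trunc_g_def)

lemma (in prob_space) covariance_eq:
  fixes f g :: "'a \<Rightarrow> real"
  assumes "integrable M f" "integrable M g" "integrable M (\<lambda>\<omega>. f \<omega> * g \<omega>)"
  shows "integrable M (\<lambda>\<omega>. (f \<omega> - expectation f) * (g \<omega> - expectation g))"
    and "expectation (\<lambda>\<omega>. (f \<omega> - expectation f) * (g \<omega> - expectation g))
      = expectation (\<lambda>\<omega>. f \<omega> * g \<omega>) - expectation f * expectation g"
proof -
  have e: "(\<lambda>\<omega>. (f \<omega> - expectation f) * (g \<omega> - expectation g))
    = (\<lambda>\<omega>. f \<omega> * g \<omega> - expectation g * f \<omega> - expectation f * g \<omega> + expectation f * expectation g)"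
    by (auto simp: algebra_simps)
  show "integrable M (\<lambda>\<omega>. (f \<omega> - expectation f) * (g \<omega> - expectation g))"
    unfolding e using assms by (auto intro!: integrable_mult_right)
  show "expectation (\<lambda>\<omega>. (f \<omega> - expectation f) * (g \<omega> - expectation g))
      = expectation (\<lambda>\<omega>. f \<omega> * g \<omega>) - expectation f * expectation g"
    unfolding e using assms by (simp add: prob_space)
qed

lemma (in prob_space) truncated_square_dominated:
  assumes [measurable]: "X \<in> borel_measurable M" "Y \<in> borel_measurable M"
    and tail: "\<And>t. t > 0 \<Longrightarrow> prob {\<omega> \<in> space M. \<bar>X \<omega>\<bar> > t} \<le> C * prob {\<omega> \<in> space M. \<bar>Y \<omega>\<bar> > t}"
    and "C \<ge> 0"
  shows "expectation (\<lambda>\<omega>. min ((X \<omega>)\<^sup>2) (c\<^sup>2)) \<le> C * expectation (\<lambda>\<omega>. min ((Y \<omega>)\<^sup>2) (c\<^sup>2))"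
proof (rule integral_le_of_tail_le)
  show "integrable M (\<lambda>\<omega>. min ((Y \<omega>)\<^sup>2) (c\<^sup>2))"
    by (intro integrable_const_bound[where B="c\<^sup>2"]) auto
  fix t :: real assume t: "t > 0"
  have e: "t < min (x\<^sup>2) (c\<^sup>2) \<longleftrightarrow> t < c\<^sup>2 \<and> \<bar>x\<bar> > sqrt t" for x :: real
    using t real_sqrt_less_iff[of t "x\<^sup>2"] by auto
  show "measure M {\<omega> \<in> space M. t < min ((X \<omega>)\<^sup>2) (c\<^sup>2)} \<le> C * measure M {\<omega> \<in> space M. t < min ((Y \<omega>)\<^sup>2) (c\<^sup>2)}"
    unfolding e using tail[of "sqrt t"] t by (cases "t < c\<^sup>2") auto
qed (use assms in \<open>auto intro: finite_measure_axioms\<close>)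

lemma (in prob_space) excess_dominated:
  assumes [measurable]: "X \<in> borel_measurable M" "Y \<in> borel_measurable M"
    and tail: "\<And>t. t > 0 \<Longrightarrow> prob {\<omega> \<in> space M. \<bar>X \<omega>\<bar> > t} \<le> C * prob {\<omega> \<in> space M. \<bar>Y \<omega>\<bar> > t}"
    and "C \<ge> 0" "c \<ge> 0" and Y: "integrable M Y"
  shows "integrable M (\<lambda>\<omega>. max (\<bar>X \<omega>\<bar> - c) 0)"
    and "expectation (\<lambda>\<omega>. max (\<bar>X \<omega>\<bar> - c) 0) \<le> C * expectation (\<lambda>\<omega>. max (\<bar>Y \<omega>\<bar> - c) 0)"
proof -
  have int: "integrable M (\<lambda>\<omega>. max (\<bar>Y \<omega>\<bar> - c) 0)" using Y by auto
  have tail': "measure M {\<omega> \<in> space M. t < max (\<bar>X \<omega>\<bar> - c) 0} \<le> C * measure M {\<omega> \<in> space M. t < max (\<bar>Y \<omega>\<bar> - c) 0}"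
    if "t > 0" for t
  proof -
    have "t < max (\<bar>x\<bar> - c) 0 \<longleftrightarrow> \<bar>x\<bar> > t + c" for x :: real using that by auto
    then show ?thesis using tail[of "t + c"] that \<open>c \<ge> 0\<close> by simp
  qed
  note * = integral_le_of_tail_le[OF _ int finite_measure_axioms _ _ \<open>C \<ge> 0\<close> tail']
  show "integrable M (\<lambda>\<omega>. max (\<bar>X \<omega>\<bar> - c) 0)" by (rule *(1)) auto
  show "expectation (\<lambda>\<omega>. max (\<bar>X \<omega>\<bar> - c) 0) \<le> C * expectation (\<lambda>\<omega>. max (\<bar>Y \<omega>\<bar> - c) 0)"
    by (rule *(2)) auto
qed

section \<open>Covariances of the clipped variables\<close>

locale dominated_pqd = prob_space M for M :: "'a measure" +
  fixes X :: "nat \<Rightarrow> 'a \<Rightarrow> real" and Y :: "'a \<Rightarrow> real" and a :: "nat \<Rightarrow> real"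
    and p D B :: real and lam :: "nat \<Rightarrow> real"
  assumes p: "1 < p" "p < 2"
    and X_meas: "\<And>n. n \<ge> 1 \<Longrightarrow> X n \<in> borel_measurable M"
    and Y_meas [measurable]: "Y \<in> borel_measurable M"
    and pqd: "pairwise_PQD M X"
    and D: "D \<ge> 0"
    and tail: "\<And>n t. n \<ge> 1 \<Longrightarrow> t > 0 \<Longrightarrow>
      prob {\<omega> \<in> space M. \<bar>X n \<omega>\<bar> > t} \<le> D * prob {\<omega> \<in> space M. \<bar>Y \<omega>\<bar> > t}"
    and Y_int: "integrable M (\<lambda>\<omega>. \<bar>Y \<omega>\<bar> powr p)"
    and B: "\<And>n. (\<Sum>k=1..n. (a k)\<^sup>2) \<le> B * real n"
    and lam: "\<forall>\<^sub>F m in sequentially. \<forall>j\<ge>1. j \<le> 2 ^ m \<longrightarrow> lam j \<le> level p m"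
    and w_int: "\<And>k j. 1 \<le> k \<Longrightarrow> k < j \<Longrightarrow>
      set_integrable lborel {lam j..} (\<lambda>t. weight t * cov_trunc M (X k) (X j) t)"
    and w_sum: "(\<lambda>(k, j). \<bar>a k * a j\<bar> * (LINT t:{lam j..}|lborel. weight t * cov_trunc M (X k) (X j) t))
      summable_on {(k, j). 1 \<le> k \<and> k < j}"
begin

text \<open>Indices are shifted to start at 0, so that the first 2 ^ m of them split exactly into
  dyadic blocks.\<close>

abbreviation "G k j t \<equiv> cov_trunc M (X (Suc k)) (X (Suc j)) t"
abbreviation "r m \<equiv> 2 powr (real m / p)"

lemma X_Suc_meas [measurable]: "X (Suc k) \<in> borel_measurable M"
  by (simp add: X_meas)

lemma G_nonneg: "k \<noteq> j \<Longrightarrow> 0 \<le> G k j t"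
  and G_mono: "k \<noteq> j \<Longrightarrow> 0 \<le> s \<Longrightarrow> s \<le> t \<Longrightarrow> G k j s \<le> G k j t"
proof -
  assume kj: "k \<noteq> j"
  have q: "joint_excess M (X (Suc k)) (X (Suc j)) x y \<ge> 0" for x y
    using pqd kj unfolding pairwise_PQD_def joint_excess_def by auto
  note nm = cov_trunc_nonneg_mono[OF prob_space_axioms X_Suc_meas X_Suc_meas q]
  show "0 \<le> G k j t" using nm(1)[of t t] cov_trunc_nonpos[OF prob_space_axioms, of t] by (cases "t \<le> 0") auto
  show "G k j s \<le> G k j t" if "0 \<le> s" "s \<le> t" using nm(2) that by blast
qed

lemma G_sym: "G k j t = G j k t"
  by (simp add: cov_trunc_def mult.commute)

lemma trunc_integrable:
  assumes "t \<ge> 0"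
  shows "integrable M (\<lambda>\<omega>. trunc_g t (X (Suc k) \<omega>))"
    and "integrable M (\<lambda>\<omega>. trunc_g t (X (Suc k) \<omega>) * trunc_g t (X (Suc j) \<omega>))"
proof -
  show "integrable M (\<lambda>\<omega>. trunc_g t (X (Suc k) \<omega>))"
    using assms by (auto intro!: integrable_const_bound[where B=t] abs_trunc_g_le)
  show "integrable M (\<lambda>\<omega>. trunc_g t (X (Suc k) \<omega>) * trunc_g t (X (Suc j) \<omega>))"
    using assms by (intro integrable_const_bound[where B="t * t"])
      (auto simp: abs_mult intro!: abs_trunc_g_le mult_mono)
qed

text \<open>PQD says nothing about k = j. Nonnegativity is that of a variance, and the upper bound
  drops the squared mean; it is uniform in k.\<close>

lemma G_diag:
  assumes "t \<ge> 0"
  shows "0 \<le> G k k t" "G k k t \<le> D * expectation (\<lambda>\<omega>. min ((Y \<omega>)\<^sup>2) (t\<^sup>2))"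
proof -
  note ti = trunc_integrable[OF assms]
  have "G k k t = expectation (\<lambda>\<omega>. (trunc_g t (X (Suc k) \<omega>) - expectation (\<lambda>\<omega>. trunc_g t (X (Suc k) \<omega>)))
      * (trunc_g t (X (Suc k) \<omega>) - expectation (\<lambda>\<omega>. trunc_g t (X (Suc k) \<omega>))))"
    using covariance_eq(2)[OF ti(1) ti(1) ti(2)] by (simp add: cov_trunc_def)
  also have "0 \<le> \<dots>" by (intro Bochner_Integration.integral_nonneg) simp
  finally show "0 \<le> G k k t" .
  have "G k k t \<le> expectation (\<lambda>\<omega>. trunc_g t (X (Suc k) \<omega>) * trunc_g t (X (Suc k) \<omega>))"
    by (simp add: cov_trunc_def)
  also have "\<dots> = expectation (\<lambda>\<omega>. min ((X (Suc k) \<omega>)\<^sup>2) (t\<^sup>2))"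
    using assms by (simp add: power2_eq_square[symmetric] trunc_g_square)
  also have "\<dots> \<le> D * expectation (\<lambda>\<omega>. min ((Y \<omega>)\<^sup>2) (t\<^sup>2))"
    using tail[of "Suc k"] D by (intro truncated_square_dominated) auto
  finally show "G k k t \<le> D * expectation (\<lambda>\<omega>. min ((Y \<omega>)\<^sup>2) (t\<^sup>2))" .
qed

lemma Y_integrable: "integrable M Y"
proof (rule Bochner_Integration.integrable_bound)
  show "integrable M (\<lambda>\<omega>. 1 + \<bar>Y \<omega>\<bar> powr p)" using Y_int by simp
  have "\<bar>y\<bar> \<le> 1 + \<bar>y\<bar> powr p" for y :: real
  proof (cases "\<bar>y\<bar> \<le> 1")
    case False
    then have "\<bar>y\<bar> powr 1 \<le> \<bar>y\<bar> powr p" using p by (intro powr_mono) auto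
    then show ?thesis by simp
  qed (simp add: add_increasing2)
  then show "AE \<omega> in M. norm (Y \<omega>) \<le> norm (1 + \<bar>Y \<omega>\<bar> powr p)"
    by (auto intro: order_trans)
qed simp

lemma a_bounds:
  shows "(\<Sum>k<n. (a (Suc k))\<^sup>2) \<le> B * real n" "(\<Sum>k<n. \<bar>a (Suc k)\<bar>) \<le> (1 + B) * real n"
proof -
  have e: "(\<Sum>k=1..n. f k) = (\<Sum>k<n. f (Suc k))" for f :: "nat \<Rightarrow> real"
    by (simp add: sum.atLeast1_atMost_eq)
  show *: "(\<Sum>k<n. (a (Suc k))\<^sup>2) \<le> B * real n" using B[of n] by (simp only: e)
  have ab: "\<bar>x\<bar> \<le> 1 + x\<^sup>2" for x :: real
    using zero_le_power2[of "\<bar>x\<bar> - 1/2"] by (simp add: power2_eq_square algebra_simps)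
  have "(\<Sum>k<n. \<bar>a (Suc k)\<bar>) \<le> (\<Sum>k<n. 1 + (a (Suc k))\<^sup>2)"
    by (intro sum_mono) (rule ab)
  then show "(\<Sum>k<n. \<bar>a (Suc k)\<bar>) \<le> (1 + B) * real n"
    using * by (simp add: sum.distrib algebra_simps)
qed

text \<open>Summing over m first: a pair k < j occurs at the levels with
  \<open>Suc j \<le> 2 ^ m\<close>, and for m \<ge> m0 all of these lie above
  \<open>lam (Suc j)\<close>. Their total is therefore bounded by the integral that the hypothesis
  attaches to the pair.\<close>

lemma summable_off_diagonal:
  "summable (\<lambda>m. (\<Sum>j<2^m. \<Sum>k<j. \<bar>a (Suc k) * a (Suc j)\<bar> * G k j (level p m)) / (r m)\<^sup>2)"
    (is "summable ?off")
proof -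
  let ?aa = "\<lambda>k j. \<bar>a (Suc k) * a (Suc j)\<bar>"
  obtain m0 where m0: "m0 \<ge> 6" "\<And>m j. m \<ge> m0 \<Longrightarrow> 1 \<le> j \<Longrightarrow> j \<le> 2 ^ m \<Longrightarrow> lam j \<le> level p m"
    using eventually_conj[OF lam eventually_ge_at_top[of 6]]
    unfolding eventually_sequentially by (metis (no_types, lifting) order_refl order_trans)
  define J where "J k j = (LINT t:{lam j..}|lborel. weight t * cov_trunc M (X k) (X j) t)" for k j
  define h where "h = (\<lambda>(k, j). \<bar>a k * a j\<bar> * J k j)"
  have at_level: "(\<Sum>m\<in>A. G k j (level p m) / (r m)\<^sup>2) \<le> 160 * J (Suc k) (Suc j)"
    if "finite A" "\<And>m. m \<in> A \<Longrightarrow> m0 \<le> m \<and> j < 2 ^ m" "k < j" for A k j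
    unfolding J_def
  proof (rule sum_at_levels_le_integral[OF p \<open>finite A\<close>])
    show "6 \<le> m \<and> lam (Suc j) \<le> level p m" if "m \<in> A" for m
      using m0 that \<open>\<And>m. m \<in> A \<Longrightarrow> m0 \<le> m \<and> j < 2 ^ m\<close>[of m] by auto
  qed (use that G_nonneg[of k j] G_mono[of k j] cov_trunc_nonpos[OF prob_space_axioms] w_int[of "Suc k" "Suc j"] in auto)
  \<comment> \<open>The empty set of levels already yields nonnegativity of the integral.\<close>
  have J0: "0 \<le> J (Suc k) (Suc j)" if "k < j" for k j
    using at_level[of "{}" j k] that by simp
  have nonneg: "?off m \<ge> 0" for m
    by (intro divide_nonneg_nonneg sum_nonneg mult_nonneg_nonneg G_nonneg) auto
  have "summable (\<lambda>i. ?off (i + m0))"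
  proof (rule summableI_nonneg_bounded)
    fix N
    \<comment> \<open>A common range for j that contains the ranges of all m < N + m0; the condition
      \<open>j < 2 ^ m\<close> moves into the summand, and the sums can be swapped.\<close>
    let ?n = "2 ^ (N + m0) :: nat"
    let ?A = "\<lambda>j. {m \<in> {m0..<N + m0}. j < 2 ^ m}"
    have "(\<Sum>i<N. ?off (i + m0)) = (\<Sum>m=m0..<N + m0. ?off m)"
      by (simp add: sum.shift_bounds_nat_ivl[of _ 0 m0 N, simplified] lessThan_atLeast0)
    also have "\<dots> = (\<Sum>m=m0..<N + m0. \<Sum>j<?n. \<Sum>k<j. if j < 2 ^ m then ?aa k j * (G k j (level p m) / (r m)\<^sup>2) else 0)"
    proof (intro sum.cong refl)
      fix m assume m: "m \<in> {m0..<N + m0}"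
      have sub: "{..<2 ^ m} \<subseteq> {..<?n}" using m by (auto intro: less_le_trans power_increasing)
      have "?off m = (\<Sum>j<2^m. \<Sum>k<j. ?aa k j * (G k j (level p m) / (r m)\<^sup>2))"
        by (simp add: sum_divide_distrib)
      also have "\<dots> = (\<Sum>j<2^m. \<Sum>k<j. if j < 2 ^ m then ?aa k j * (G k j (level p m) / (r m)\<^sup>2) else 0)"
        by (intro sum.cong) auto
      also have "\<dots> = (\<Sum>j<?n. \<Sum>k<j. if j < 2 ^ m then ?aa k j * (G k j (level p m) / (r m)\<^sup>2) else 0)"
        using sub by (intro sum.mono_neutral_left) auto
      finally show "?off m = \<dots>" .
    qed
    also have "\<dots> = (\<Sum>j<?n. \<Sum>m=m0..<N + m0. \<Sum>k<j. if j < 2 ^ m then ?aa k j * (G k j (level p m) / (r m)\<^sup>2) else 0)"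
      by (rule sum.swap)
    also have "\<dots> = (\<Sum>j<?n. \<Sum>k<j. \<Sum>m=m0..<N + m0. if j < 2 ^ m then ?aa k j * (G k j (level p m) / (r m)\<^sup>2) else 0)"
      by (intro sum.cong refl sum.swap)
    also have "\<dots> = (\<Sum>j<?n. \<Sum>k<j. ?aa k j * (\<Sum>m\<in>?A j. G k j (level p m) / (r m)\<^sup>2))"
      by (simp only: sum.inter_filter[OF finite_atLeastLessThan, symmetric] sum_distrib_left)
    also have "\<dots> \<le> (\<Sum>j<?n. \<Sum>k<j. ?aa k j * (160 * J (Suc k) (Suc j)))"
      by (intro sum_mono mult_left_mono at_level) auto
    also have "\<dots> = 160 * (\<Sum>j<?n. \<Sum>k<j. h (Suc k, Suc j))"
      by (simp add: h_def sum_distrib_left mult_ac)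
    also have "(\<Sum>j<?n. \<Sum>k<j. h (Suc k, Suc j)) = (\<Sum>(j, k)\<in>Sigma {..<?n} (\<lambda>j. {..<j}). h (Suc k, Suc j))"
      by (intro sum.Sigma) auto
    also have "\<dots> = sum h ((\<lambda>(j, k). (Suc k, Suc j)) ` Sigma {..<?n} (\<lambda>j. {..<j}))"
      by (subst sum.reindex) (auto simp: inj_on_def case_prod_beta)
    also have "\<dots> \<le> infsum h {(k, j). 1 \<le> k \<and> k < j}"
    proof (rule finite_sum_le_infsum)
      show "h summable_on {(k, j). 1 \<le> k \<and> k < j}" using w_sum unfolding h_def J_def .
      fix x assume "x \<in> {(k, j). 1 \<le> k \<and> k < j} - (\<lambda>(j, k). (Suc k, Suc j)) ` Sigma {..<?n} (\<lambda>j. {..<j})"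
      then obtain k j where "x = (k, j)" "1 \<le> k" "k < j" by auto
      then show "0 \<le> h x" using J0[of "k - 1" "j - 1"] by (simp add: h_def)
    qed auto
    finally show "(\<Sum>i<N. ?off (i + m0)) \<le> 160 * infsum h {(k, j). 1 \<le> k \<and> k < j}" by simp
  qed (rule nonneg)
  then show ?thesis by (rule iffD1[OF summable_iff_shift])
qed

text \<open>As the variance bound is uniform in k, the coefficients enter only through the bound
  \<open>B * 2 ^ m\<close> on their squares, and the series over m becomes the expectation of a
  pointwise sum in Y.\<close>

lemma summable_diagonal:
  "summable (\<lambda>m. (\<Sum>k<2^m. (a (Suc k))\<^sup>2 * G k k (level p m)) / (r m)\<^sup>2)"
proof -
  define E where "E m = expectation (\<lambda>\<omega>. min ((Y \<omega>)\<^sup>2) ((level p m)\<^sup>2))" for m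
  have int: "integrable M (\<lambda>\<omega>. min ((Y \<omega>)\<^sup>2) ((level p m)\<^sup>2))" for m
    by (intro integrable_const_bound[where B="(level p m)\<^sup>2"]) auto
  obtain K where K: "\<And>v N. (\<Sum>i<N. 2 ^ (i + 6) / (r (i + 6))\<^sup>2 * min (v\<^sup>2) ((level p (i + 6))\<^sup>2)) \<le> K * \<bar>v\<bar> powr p"
    using sum_truncated_square_le[OF p] by blast
  have "summable (\<lambda>i. expectation (\<lambda>\<omega>. 2 ^ (i + 6) / (r (i + 6))\<^sup>2 * min ((Y \<omega>)\<^sup>2) ((level p (i + 6))\<^sup>2)))"
    using Y_int by (intro summable_integral_of_sum_le[OF _ _ _ K] integrable_mult_right int) auto
  then have "summable (\<lambda>i. 2 ^ (i + 6) / (r (i + 6))\<^sup>2 * E (i + 6))"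
    by (simp only: E_def integral_mult_right_zero)
  then have "summable (\<lambda>m. 2 ^ m / (r m)\<^sup>2 * E m)"
    by (simp only: summable_iff_shift[of "\<lambda>m. 2 ^ m / (r m)\<^sup>2 * E m" 6])
  then have "summable (\<lambda>m. B * D * (2 ^ m / (r m)\<^sup>2 * E m))" by (rule summable_mult)
  then show ?thesis
  proof (rule summable_comparison_test'[where N=0])
    fix m
    have E0: "0 \<le> E m" unfolding E_def by (intro Bochner_Integration.integral_nonneg) auto
    have "(\<Sum>k<2^m. (a (Suc k))\<^sup>2 * G k k (level p m)) \<le> (\<Sum>k<2^m. (a (Suc k))\<^sup>2 * (D * E m))"
      unfolding E_def by (intro sum_mono mult_left_mono G_diag level_nonneg) auto
    also have "\<dots> \<le> B * real (2 ^ m) * (D * E m)"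
      unfolding sum_distrib_right[symmetric] using D E0 by (intro mult_right_mono a_bounds) auto
    finally have "(\<Sum>k<2^m. (a (Suc k))\<^sup>2 * G k k (level p m)) / (r m)\<^sup>2 \<le> B * real (2 ^ m) * (D * E m) / (r m)\<^sup>2"
      by (intro divide_right_mono) auto
    moreover have "0 \<le> (\<Sum>k<2^m. (a (Suc k))\<^sup>2 * G k k (level p m)) / (r m)\<^sup>2"
      by (intro divide_nonneg_nonneg sum_nonneg mult_nonneg_nonneg G_diag level_nonneg) auto
    ultimately show "norm ((\<Sum>k<2^m. (a (Suc k))\<^sup>2 * G k k (level p m)) / (r m)\<^sup>2) \<le> B * D * (2 ^ m / (r m)\<^sup>2 * E m)"
      by (simp add: mult_ac)
  qed
qed

lemma summable_excess:
  "summable (\<lambda>m. 2 ^ m / (r m * real m) * expectation (\<lambda>\<omega>. max (\<bar>Y \<omega>\<bar> - level p m) 0))"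
proof -
  obtain K where K: "\<And>v N. (\<Sum>i<N. 2 ^ (i + 6) / (r (i + 6) * real (i + 6)) * max (\<bar>v\<bar> - level p (i + 6)) 0) \<le> K * \<bar>v\<bar> powr p"
    using sum_excess_le[OF p] by blast
  have "summable (\<lambda>i. expectation (\<lambda>\<omega>. 2 ^ (i + 6) / (r (i + 6) * real (i + 6)) * max (\<bar>Y \<omega>\<bar> - level p (i + 6)) 0))"
    using Y_int Y_integrable by (intro summable_integral_of_sum_le[OF _ _ _ K] integrable_mult_right) auto
  then show ?thesis
    by (simp only: integral_mult_right_zero
      summable_iff_shift[of "\<lambda>m. 2 ^ m / (r m * real m) * expectation (\<lambda>\<omega>. max (\<bar>Y \<omega>\<bar> - level p m) 0)" 6])
qed

section \<open>The truncated part and the remainder\<close>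

text \<open>A separate array for each m: all variables of a block are clipped at the same level, so
  that every covariance is a value of a function \<open>G k j\<close> at that level.\<close>

definition Z :: "nat \<Rightarrow> nat \<Rightarrow> 'a \<Rightarrow> real" where
  "Z m k \<omega> = a (Suc k) * (trunc_g (level p m) (X (Suc k) \<omega>)
     - expectation (\<lambda>\<omega>. trunc_g (level p m) (X (Suc k) \<omega>)))"

lemma Z_covariance:
  "integrable M (\<lambda>\<omega>. Z m k \<omega> * Z m j \<omega>)"
  "expectation (\<lambda>\<omega>. Z m k \<omega> * Z m j \<omega>) = a (Suc k) * a (Suc j) * G k j (level p m)"
proof -
  note ti = trunc_integrable[OF level_nonneg[of p m]]
  note c = covariance_eq[OF ti(1)[of k] ti(1)[of j] ti(2)[of k j]]
  have e: "(\<lambda>\<omega>. Z m k \<omega> * Z m j \<omega>) = (\<lambda>\<omega>. a (Suc k) * a (Suc j) * (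
     (trunc_g (level p m) (X (Suc k) \<omega>) - expectation (\<lambda>\<omega>. trunc_g (level p m) (X (Suc k) \<omega>))) *
     (trunc_g (level p m) (X (Suc j) \<omega>) - expectation (\<lambda>\<omega>. trunc_g (level p m) (X (Suc j) \<omega>)))))"
    by (simp add: Z_def mult_ac)
  show "integrable M (\<lambda>\<omega>. Z m k \<omega> * Z m j \<omega>)" unfolding e using c(1) by (intro integrable_mult_right)
  show "expectation (\<lambda>\<omega>. Z m k \<omega> * Z m j \<omega>) = a (Suc k) * a (Suc j) * G k j (level p m)"
    unfolding e integral_mult_right_zero c(2) cov_trunc_def ..
qed

lemma truncated_part:
  obtains W where "\<And>m \<omega>. W m \<omega> \<ge> 0"
    "\<And>m n \<omega>. n < 2 ^ m \<Longrightarrow> (\<Sum>k<n. Z m k \<omega>)\<^sup>2 \<le> W m \<omega>"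
    "AE \<omega> in M. (\<lambda>m. W m \<omega> / (r m * real m)\<^sup>2) \<longlonglongrightarrow> 0"
proof -
  let ?V = "\<lambda>m. \<Sum>k<2^m. \<Sum>j<2^m. \<bar>\<integral>\<omega>. Z m k \<omega> * Z m j \<omega> \<partial>M\<bar>"
  have "\<exists>W. integrable M W \<and> (\<forall>\<omega>. W \<omega> \<ge> 0) \<and> (\<forall>n \<omega>. n < 2 ^ m \<longrightarrow> (\<Sum>k<n. Z m k \<omega>)\<^sup>2 \<le> W \<omega>) \<and>
    (\<integral>\<omega>. W \<omega> \<partial>M) \<le> (real m)\<^sup>2 * ?V m" for m
    by (rule rademacher_menshov[of M "Z m" m, OF Z_covariance(1)]) blast
  from choice[OF allI, OF this] obtain W where "\<forall>m. integrable M (W m) \<and> (\<forall>\<omega>. W m \<omega> \<ge> 0) \<and>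
    (\<forall>n \<omega>. n < 2 ^ m \<longrightarrow> (\<Sum>k<n. Z m k \<omega>)\<^sup>2 \<le> W m \<omega>) \<and> (\<integral>\<omega>. W m \<omega> \<partial>M) \<le> (real m)\<^sup>2 * ?V m" ..
  then have W: "\<And>m. integrable M (W m)" "\<And>m \<omega>. W m \<omega> \<ge> 0"
      "\<And>m n \<omega>. n < 2 ^ m \<Longrightarrow> (\<Sum>k<n. Z m k \<omega>)\<^sup>2 \<le> W m \<omega>"
      "\<And>m. (\<integral>\<omega>. W m \<omega> \<partial>M) \<le> (real m)\<^sup>2 * ?V m"
    by simp_all
  \<comment> \<open>Off the diagonal G is nonnegative, so the absolute values required by
    Rademacher--Menshov fall on the coefficients alone and match the series in the
    hypothesis.\<close>
  have V: "?V m / (r m)\<^sup>2 = (\<Sum>k<2^m. (a (Suc k))\<^sup>2 * G k k (level p m)) / (r m)\<^sup>2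
      + 2 * ((\<Sum>j<2^m. \<Sum>k<j. \<bar>a (Suc k) * a (Suc j)\<bar> * G k j (level p m)) / (r m)\<^sup>2)" for m
  proof -
    have "?V m = (\<Sum>k<2^m. \<bar>\<integral>\<omega>. Z m k \<omega> * Z m k \<omega> \<partial>M\<bar>) + 2 * (\<Sum>j<2^m. \<Sum>k<j. \<bar>\<integral>\<omega>. Z m k \<omega> * Z m j \<omega> \<partial>M\<bar>)"
      by (rule double_sum_symmetric) (simp add: mult.commute)
    also have "(\<Sum>k<2^m. \<bar>\<integral>\<omega>. Z m k \<omega> * Z m k \<omega> \<partial>M\<bar>) = (\<Sum>k<2^m. (a (Suc k))\<^sup>2 * G k k (level p m))"
      using G_diag(1)[OF level_nonneg] by (simp add: Z_covariance abs_mult power2_eq_square abs_of_nonneg)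
    also have "(\<Sum>j<2^m. \<Sum>k<j. \<bar>\<integral>\<omega>. Z m k \<omega> * Z m j \<omega> \<partial>M\<bar>)
        = (\<Sum>j<2^m. \<Sum>k<j. \<bar>a (Suc k) * a (Suc j)\<bar> * G k j (level p m))"
      using G_nonneg by (intro sum.cong) (auto simp: Z_covariance abs_mult)
    finally show ?thesis by (simp add: add_divide_distrib)
  qed
  have "summable (\<lambda>m. ?V m / (r m)\<^sup>2)"
    unfolding V by (intro summable_add summable_mult summable_diagonal summable_off_diagonal)
  then have "summable (\<lambda>m. \<integral>\<omega>. W m \<omega> / (r m * real m)\<^sup>2 \<partial>M)"
  proof (rule summable_comparison_test'[where N=0])
    fix m
    have "(\<integral>\<omega>. W m \<omega> / (r m * real m)\<^sup>2 \<partial>M) \<le> (real m)\<^sup>2 * ?V m / (r m * real m)\<^sup>2"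
      using W(4)[of m] by (simp add: divide_right_mono)
    \<comment> \<open>Here the two logarithmic factors cancel. At m = 0 the left side is a division
      by zero, with value 0.\<close>
    also have "\<dots> \<le> ?V m / (r m)\<^sup>2"
      by (cases "m = 0") (auto simp: power_mult_distrib sum_nonneg)
    finally show "norm (\<integral>\<omega>. W m \<omega> / (r m * real m)\<^sup>2 \<partial>M) \<le> ?V m / (r m)\<^sup>2"
      using W(2) by (simp add: Bochner_Integration.integral_nonneg)
  qed
  then have "AE \<omega> in M. (\<lambda>m. W m \<omega> / (r m * real m)\<^sup>2) \<longlonglongrightarrow> 0"
    using W by (intro AE_tendsto_zero_of_summable_integral) auto
  with W show ?thesis by (intro that[of W])
qed

text \<open>The modulus of what clipping removes from \<open>X (Suc k)\<close>.\<close>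

definition R :: "nat \<Rightarrow> nat \<Rightarrow> 'a \<Rightarrow> real" where
  "R m k \<omega> = max (\<bar>X (Suc k) \<omega>\<bar> - level p m) 0"

lemma R_integrable: "integrable M (R m k)"
  and R_expectation: "expectation (R m k) \<le> D * expectation (\<lambda>\<omega>. max (\<bar>Y \<omega>\<bar> - level p m) 0)"
  unfolding R_def[abs_def]
  by (intro excess_dominated; use tail[of "Suc k"] D level_nonneg Y_integrable in auto)+

lemma X_integrable: "integrable M (X (Suc k))"
proof -
  have "integrable M (\<lambda>\<omega>. max (\<bar>X (Suc k) \<omega>\<bar> - 0) 0)"
    using tail[of "Suc k"] D Y_integrable by (intro excess_dominated) auto
  then show ?thesis using integrable_abs_iff[of "X (Suc k)" M] by (simp add: max_absorb1)
qed

lemma R_nonneg: "0 \<le> R m k \<omega>" by (simp add: R_def)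

text \<open>No maximal inequality is involved: the terms are nonnegative, so the sum over the block
  dominates all shorter ones, and its expectation is summable after norming. The mean of
  \<open>R m k\<close> appears because the removed part has to be centred too.\<close>

lemma remainder_part:
  "AE \<omega> in M. (\<lambda>m. (\<Sum>k<2^m. \<bar>a (Suc k)\<bar> * (R m k \<omega> + expectation (R m k))) / (r m * real m)) \<longlonglongrightarrow> 0"
proof (rule AE_tendsto_zero_of_summable_integral)
  let ?Q = "\<lambda>m \<omega>. (\<Sum>k<2^m. \<bar>a (Suc k)\<bar> * (R m k \<omega> + expectation (R m k))) / (r m * real m)"
  let ?e = "\<lambda>m. expectation (\<lambda>\<omega>. max (\<bar>Y \<omega>\<bar> - level p m) 0)"
  have R0: "0 \<le> expectation (R m k)" for m k
    by (intro Bochner_Integration.integral_nonneg R_nonneg)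
  show Q0: "?Q m \<omega> \<ge> 0" for m \<omega>
    by (intro divide_nonneg_nonneg sum_nonneg mult_nonneg_nonneg add_nonneg_nonneg R_nonneg R0) auto
  show "integrable M (?Q m)" for m using R_integrable by auto
  have "summable (\<lambda>m. 2 * (1 + B) * D * (2 ^ m / (r m * real m) * ?e m))"
    by (rule summable_mult[OF summable_excess])
  then show "summable (\<lambda>m. expectation (?Q m))"
  proof (rule summable_comparison_test'[where N=0])
    fix m
    have e0: "0 \<le> ?e m" by (intro Bochner_Integration.integral_nonneg) auto
    have "expectation (?Q m) = (\<Sum>k<2^m. \<bar>a (Suc k)\<bar> * (2 * expectation (R m k))) / (r m * real m)"
      using R_integrable by (simp add: Bochner_Integration.integral_sum prob_space)
    also have "\<dots> \<le> (\<Sum>k<2^m. \<bar>a (Suc k)\<bar> * (2 * (D * ?e m))) / (r m * real m)"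
      using R_expectation by (intro divide_right_mono sum_mono mult_left_mono) auto
    also have "\<dots> \<le> ((1 + B) * real (2 ^ m) * (2 * (D * ?e m))) / (r m * real m)"
      unfolding sum_distrib_right[symmetric] using D e0
      by (intro divide_right_mono mult_right_mono a_bounds) auto
    also have "\<dots> = 2 * (1 + B) * D * (2 ^ m / (r m * real m) * ?e m)" by simp
    finally show "norm (expectation (?Q m)) \<le> 2 * (1 + B) * D * (2 ^ m / (r m * real m) * ?e m)"
      using Bochner_Integration.integral_nonneg[of M "?Q m", OF Q0] by (simp only: real_norm_def abs_of_nonneg)
  qed
qed

text \<open>The error of the k-th term is \<open>a (Suc k)\<close> times the centred removed part d,
  and |d| is \<open>R m k\<close>. Extending the error sum to 2 ^ m frees it from n.\<close>

lemma partial_sum_split: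
  assumes "n \<le> 2 ^ m"
  shows "\<bar>\<Sum>k<n. a (Suc k) * (X (Suc k) \<omega> - expectation (X (Suc k)))\<bar>
    \<le> \<bar>\<Sum>k<n. Z m k \<omega>\<bar> + (\<Sum>k<2^m. \<bar>a (Suc k)\<bar> * (R m k \<omega> + expectation (R m k)))"
proof -
  let ?t = "trunc_g (level p m)"
  have l: "0 \<le> level p m" by (rule level_nonneg)
  have R0: "0 \<le> expectation (R m k)" for m k
    by (intro Bochner_Integration.integral_nonneg R_nonneg)
  have one: "\<bar>a (Suc k) * (X (Suc k) \<omega> - expectation (X (Suc k))) - Z m k \<omega>\<bar>
     \<le> \<bar>a (Suc k)\<bar> * (R m k \<omega> + expectation (R m k))" for k
  proof -
    define d where "d \<omega> = X (Suc k) \<omega> - ?t (X (Suc k) \<omega>)" for \<omega>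
    have d: "\<bar>d \<omega>\<bar> = R m k \<omega>" for \<omega> using abs_diff_trunc_g[OF l] by (simp add: d_def R_def)
    have Ed: "expectation d = expectation (X (Suc k)) - expectation (\<lambda>\<omega>. ?t (X (Suc k) \<omega>))"
      unfolding d_def using X_integrable trunc_integrable(1)[OF l] by simp
    have "a (Suc k) * (X (Suc k) \<omega> - expectation (X (Suc k))) - Z m k \<omega> = a (Suc k) * (d \<omega> - expectation d)"
      unfolding Ed Z_def by (simp add: d_def algebra_simps)
    moreover have "\<bar>expectation d\<bar> \<le> expectation (\<lambda>\<omega>. \<bar>d \<omega>\<bar>)" by (rule integral_abs_bound)
    then have "\<bar>d \<omega> - expectation d\<bar> \<le> R m k \<omega> + expectation (R m k)"
      unfolding d using d[of \<omega>] by linarith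
    ultimately show ?thesis by (simp add: abs_mult mult_left_mono)
  qed
  have "(\<Sum>k<n. a (Suc k) * (X (Suc k) \<omega> - expectation (X (Suc k))))
     = (\<Sum>k<n. Z m k \<omega>) + (\<Sum>k<n. a (Suc k) * (X (Suc k) \<omega> - expectation (X (Suc k))) - Z m k \<omega>)"
    by (simp add: sum.distrib[symmetric])
  moreover have "\<bar>\<Sum>k<n. a (Suc k) * (X (Suc k) \<omega> - expectation (X (Suc k))) - Z m k \<omega>\<bar>
     \<le> (\<Sum>k<n. \<bar>a (Suc k)\<bar> * (R m k \<omega> + expectation (R m k)))"
    by (intro order_trans[OF sum_abs] sum_mono one)
  moreover have "\<dots> \<le> (\<Sum>k<2^m. \<bar>a (Suc k)\<bar> * (R m k \<omega> + expectation (R m k)))"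
    using assms R0 R_nonneg by (intro sum_mono2) auto
  ultimately show ?thesis by linarith
qed

lemma strong_law:
  "AE \<omega> in M. (\<lambda>n. (\<Sum>k=1..n. a k * (X k \<omega> - expectation (X k)))
      / (real n powr (1/p) * Log (real n))) \<longlonglongrightarrow> 0"
proof -
  obtain W where W: "\<And>m \<omega>. W m \<omega> \<ge> 0"
    "\<And>m n \<omega>. n < 2 ^ m \<Longrightarrow> (\<Sum>k<n. Z m k \<omega>)\<^sup>2 \<le> W m \<omega>"
    "AE \<omega> in M. (\<lambda>m. W m \<omega> / (r m * real m)\<^sup>2) \<longlonglongrightarrow> 0"
    using truncated_part by blast
  let ?Q = "\<lambda>m \<omega>. \<Sum>k<2^m. \<bar>a (Suc k)\<bar> * (R m k \<omega> + expectation (R m k))"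
  from W(3) remainder_part show ?thesis
  proof eventually_elim
    case (elim \<omega>)
    show ?case
    proof (rule tendsto_of_dyadic_bound[OF p(1), where T="\<lambda>m. sqrt (W m \<omega>) + ?Q m \<omega>"])
      show "\<bar>\<Sum>k=1..n. a k * (X k \<omega> - expectation (X k))\<bar> \<le> sqrt (W m \<omega>) + ?Q m \<omega>"
        if "n < 2 ^ m" for m n
      proof -
        have "\<bar>\<Sum>k<n. Z m k \<omega>\<bar> \<le> sqrt (W m \<omega>)"
          using W(2)[OF that, of \<omega>] by (intro real_le_rsqrt) simp
        then show ?thesis using partial_sum_split[of n m \<omega>] that
          by (simp add: sum.atLeast1_atMost_eq)
      qed
      have "(\<lambda>m. sqrt (W m \<omega> / (r m * real m)\<^sup>2) + ?Q m \<omega> / (r m * real m)) \<longlonglongrightarrow> sqrt 0 + 0"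
        using elim by (intro tendsto_add tendsto_real_sqrt)
      moreover have "sqrt (W m \<omega> / (r m * real m)\<^sup>2) = sqrt (W m \<omega>) / (r m * real m)" for m
        by (simp add: real_sqrt_divide)
      ultimately show "(\<lambda>m. (sqrt (W m \<omega>) + ?Q m \<omega>) / (r m * real m)) \<longlonglongrightarrow> 0"
        by (simp add: add_divide_distrib)
    qed
  qed
qed

end

text \<open>\<open>LINT\<close> takes the value 0 on functions that are not integrable, so
  finiteness of the individual integrals is stated separately from the summability over
  pairs.\<close>

theorem theorem2:
  fixes M :: "'a measure" and X :: "nat \<Rightarrow> 'a \<Rightarrow> real" and Y :: "'a \<Rightarrow> real"
    and a :: "nat \<Rightarrow> real" and p C :: real and lam :: "nat \<Rightarrow> real"
  assumes "prob_space M"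
    and "1 < p" "p < 2"
    and "\<And>n. n \<ge> 1 \<Longrightarrow> X n \<in> borel_measurable M"
    and "Y \<in> borel_measurable M"
    and "pairwise_PQD M X"
    and "stoch_dominated M X Y"
    and "integrable M (\<lambda>\<omega>. \<bar>Y \<omega>\<bar> powr p)"
    and "\<exists>B. \<forall>n\<ge>1. (\<Sum>k=1..n. (a k)\<^sup>2) / real n \<le> B"
    and "C > 0"
    and "(\<lambda>j. lam j - C * (real j powr (1/p) / Log (real j) powr (2/p)))
           \<in> o(\<lambda>j. real j powr (1/p) / Log (real j) powr (2/p))"
    and "\<And>k j. 1 \<le> k \<Longrightarrow> k < j \<Longrightarrow> set_integrable lborel {lam j..}
           (\<lambda>t. (1 / (t ^ 3 * Log t ^ 2) + 1 / (max t (exp 1) * t ^ 2 * Log t ^ 3))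
                 * cov_trunc M (X k) (X j) t)"
    and "(\<lambda>(k, j). \<bar>a k * a j\<bar> * (LINT t:{lam j..}|lborel.
            (1 / (t ^ 3 * Log t ^ 2) + 1 / (max t (exp 1) * t ^ 2 * Log t ^ 3))
              * cov_trunc M (X k) (X j) t))
         summable_on {(k, j). 1 \<le> k \<and> k < j}"
  shows "AE \<omega> in M. (\<lambda>n. (\<Sum>k=1..n. a k * (X k \<omega> - (\<integral>\<omega>'. X k \<omega>' \<partial>M)))
                          / (real n powr (1/p) * Log (real n))) \<longlonglongrightarrow> 0"
proof -
  obtain D where D: "D > 0" "\<And>n t. n \<ge> 1 \<Longrightarrow> t > 0 \<Longrightarrow>
      measure M {\<omega> \<in> space M. \<bar>X n \<omega>\<bar> > t} \<le> D * measure M {\<omega> \<in> space M. \<bar>Y \<omega>\<bar> > t}"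
    using \<open>stoch_dominated M X Y\<close> unfolding stoch_dominated_def by blast
  obtain B where "\<And>n. n \<ge> 1 \<Longrightarrow> (\<Sum>k=1..n. (a k)\<^sup>2) / real n \<le> B"
    using assms(9) by blast
  then have B: "(\<Sum>k=1..n. (a k)\<^sup>2) \<le> B * real n" for n
    by (cases "n = 0") (auto simp: divide_le_eq)
  interpret dominated_pqd M X Y a p D B lam
  proof (intro dominated_pqd.intro dominated_pqd_axioms.intro)
    show "\<forall>\<^sub>F m in sequentially. \<forall>j\<ge>1. j \<le> 2 ^ m \<longrightarrow> lam j \<le> level p m"
      using assms(2,3,10,11) by (rule eventually_le_level)
  qed (use assms D B in \<open>auto simp: weight_def\<close>)
  show ?thesis by (rule strong_law)
qed

end
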